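(* Let $(X_i)_{i\in\mathbb Z}$ be a strictly stationary sequence of random variables, defined on a probability space $(\Omega,\mathcal T,\mathbb P)$, with values in a Polish space $E$, with strong mixing coefficients $(\alpha_{\infty,1}(n))_{n\ge 0}$, and let $\mu$ be the law of $X_0$. Let $(A_k)_{k>0}$ be a sequence of Borel sets in $E$ with $\mu(A_1)>0$ and $\sum_{k>0}\mu(A_k)=+\infty$. For $k>0$ let $B_k=\{X_k\in A_k\}$, and let $E_n=\sum_{k=1}^n\mu(A_k)$. Assume that there exist $a>0$ and a constant $C$ such that $\alpha_{\infty,1}(n)\le Cn^{-a}$ for $n\ge1$. 1. If $\sum_{n\ge1}(\mu(A_n))^{(a+1)/a}=\infty$, $\lim_n n^a\mu(A_n)=\infty$ and $(\mu(A_n))_{n\ge1}$ is non-increasing, then $(B_k)_{k>0}$ is a Borel-Cantelli sequence. 2. If $\lim_n n^{-1/(a+1)}E_n=\infty$, then $(B_k)_{k>0}$ is an $L^1$ Borel-Cantelli sequence. 3. If $\sum_{n>0}n^{1/(a+1)}\mu(A_n)E_n^{-2}<\infty$, then $(B_k)_{k>0}$ is a strongly Borel-Cantelli sequence.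
   Context: For events $(B_k)_{k>0}$, write $S_n=\sum_{k=1}^n\mathbf 1_{B_k}$ and $E_n=\mathbb E(S_n)$. $(B_k)_{k>0}$ is a Borel-Cantelli sequence if $\mathbb P(\limsup_kB_k)=1$; it is an $L^1$ Borel-Cantelli sequence if $\sum_k\mathbb P(B_k)=\infty$ and $\lim_n\|S_n/E_n-1\|_1=0$; it is a strongly Borel-Cantelli sequence if $\sum_k\mathbb P(B_k)=\infty$ and $\lim_nS_n/E_n=1$ a.s. For $\sigma$-fields $\mathcal A,\mathcal B\subset\mathcal T$, $\alpha(\mathcal A,\mathcal B)=\sup\{|\mathbb P(A\cap B)-\mathbb P(A)\mathbb P(B)|:A\in\mathcal A,\ B\in\mathcal B\}$. With $\mathcal F_m=\sigma(X_k:k\le m)$, $\alpha_{\infty,1}(n)=\alpha(\mathcal F_{-n},\sigma(X_0))$. *)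

theory Defs
  imports "HOL-Probability.Probability"
begin

text \<open>A process indexed by the integers is strictly stationary if its law, as a measure on
  the product space, is invariant under all shifts of time. The definition is meant for
  families of measurable maps only: \<^const>\<open>distr\<close> carries no information otherwise.\<close>

definition strictly_stationary ::
    "'w measure \<Rightarrow> 'e measure \<Rightarrow> (int \<Rightarrow> 'w \<Rightarrow> 'e) \<Rightarrow> bool" where
  "strictly_stationary M N X \<longleftrightarrow>
     (\<forall>h. distr M (\<Pi>\<^sub>M i\<in>UNIV. N) (\<lambda>\<omega> i. X (i + h) \<omega>)
        = distr M (\<Pi>\<^sub>M i\<in>UNIV. N) (\<lambda>\<omega> i. X i \<omega>))"

definition generated_sigma ::
    "'w measure \<Rightarrow> 'e measure \<Rightarrow> ('i \<Rightarrow> 'w \<Rightarrow> 'e) \<Rightarrow> 'i set \<Rightarrow> 'w set set" where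
  "generated_sigma M N X I =
     sigma_sets (space M) {X i -` U \<inter> space M | i U. i \<in> I \<and> U \<in> sets N}"

text \<open>The normalisation is without the factor 2 that some authors use. If both families are
  nonempty, the real supremum is over a nonempty set bounded by 1, for a probability
  measure.\<close>

definition alpha_coeff :: "'w measure \<Rightarrow> 'w set set \<Rightarrow> 'w set set \<Rightarrow> real" where
  "alpha_coeff M \<A> \<B> =
     (SUP (A, B) \<in> \<A> \<times> \<B>. \<bar>measure M (A \<inter> B) - measure M A * measure M B\<bar>)"

definition alpha_inf_1 ::
    "'w measure \<Rightarrow> 'e measure \<Rightarrow> (int \<Rightarrow> 'w \<Rightarrow> 'e) \<Rightarrow> nat \<Rightarrow> real" where
  "alpha_inf_1 M N X n =
     alpha_coeff M (generated_sigma M N X {..- int n}) (generated_sigma M N X {0})"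

text \<open>Sequences of events are indexed by the positive integers; the value of \<open>B\<close> at 0 is
  irrelevant to all the notions below.\<close>

definition event_count :: "(nat \<Rightarrow> 'w set) \<Rightarrow> nat \<Rightarrow> 'w \<Rightarrow> real" where
  "event_count B n \<omega> = (\<Sum>k=1..n. indicator (B k) \<omega>)"

definition event_mean :: "'w measure \<Rightarrow> (nat \<Rightarrow> 'w set) \<Rightarrow> nat \<Rightarrow> real" where
  "event_mean M B n = (\<integral>\<omega>. event_count B n \<omega> \<partial>M)"

definition borel_cantelli_seq :: "'w measure \<Rightarrow> (nat \<Rightarrow> 'w set) \<Rightarrow> bool" where
  "borel_cantelli_seq M B \<longleftrightarrow> measure M (limsup B) = 1"

definition L1_borel_cantelli_seq :: "'w measure \<Rightarrow> (nat \<Rightarrow> 'w set) \<Rightarrow> bool" where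
  "L1_borel_cantelli_seq M B \<longleftrightarrow>
     \<not> summable (\<lambda>k. measure M (B (Suc k))) \<and>
     (\<lambda>n. \<integral>\<omega>. \<bar>event_count B n \<omega> / event_mean M B n - 1\<bar> \<partial>M) \<longlonglongrightarrow> 0"

definition strongly_borel_cantelli_seq :: "'w measure \<Rightarrow> (nat \<Rightarrow> 'w set) \<Rightarrow> bool" where
  "strongly_borel_cantelli_seq M B \<longleftrightarrow>
     \<not> summable (\<lambda>k. measure M (B (Suc k))) \<and>
     (AE \<omega> in M. (\<lambda>n. event_count B n \<omega> / event_mean M B n) \<longlonglongrightarrow> 1)"

end

theory Submission
  imports Defs
begin

text \<open>With \<open>g\<^sub>k = P(B\<^sub>k | \<F>\<^bsub>k-q\<^esub>)\<close>, write \<open>S\<^sub>n - E\<^sub>n = U + V\<close> where \<open>U\<close> sums the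
  \<open>\<one>\<^bsub>B\<^sub>k\<^esub> - g\<^sub>k\<close> and \<open>V\<close> the \<open>g\<^sub>k - P(B\<^sub>k)\<close>. The summands of \<open>U\<close> are orthogonal at distance
  at least \<open>q\<close>, so \<open>\<parallel>U\<parallel>\<^sub>2\<^sup>2 \<le> 2 q E\<^sub>n\<close>, while mixing gives \<open>\<parallel>V\<parallel>\<^sub>1 \<le> 2 n \<alpha>(q)\<close>. The choice
  \<open>q \<approx> r\<^sub>n = n powr (1/(a+1))\<close> balances the two: up to constants, \<open>\<parallel>U\<parallel>\<^sub>2\<^sup>2 \<le> r\<^sub>n E\<^sub>n\<close> and
  \<open>\<parallel>V\<parallel>\<^sub>1 \<le> r\<^sub>n\<close>, for every \<open>a > 0\<close> (a bound on the variance alone fails for \<open>a \<le> 1\<close>).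
  This gives the second claim. For the third, the hypothesis makes
  \<open>\<Sum> (P(B\<^sub>n)/E\<^sub>n) (U\<^sub>n\<^sup>2/E\<^sub>n\<^sup>2 + \<bar>V\<^sub>n\<bar>/E\<^sub>n)\<close> finite almost surely. If \<open>S\<^sub>n/E\<^sub>n\<close> were far from 1 for
  infinitely many \<open>n\<close>, it would by monotonicity stay away from 1 on a whole window of indices
  with \<open>E\<^sub>k\<close> comparable to \<open>E\<^sub>n\<close>, and each window contributes a fixed positive amount.
  For the first claim, suppose the probability \<open>u\<^sub>n\<close> of no event between times \<open>L\<close> and \<open>n\<close>
  stays above \<open>l > 0\<close>. In the dyadic block \<open>(2^i, 2^(i+1)]\<close>, look only at times spaced by a gap
  \<open>G\<close> with \<open>C G powr (-a) \<le> l p/2\<close>, where \<open>p = P(B\<^sub>k)\<close> at \<open>k = 2^(i+1)\<close>: each of them lowers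
  \<open>u\<close> by \<open>l p/2\<close>, and summing over blocks contradicts the divergence of the series by Cauchy
  condensation.\<close>

subsection \<open>Mixing across time shifts\<close>

locale stationary_process = prob_space M for M :: "'w measure" +
  fixes N :: "'e measure" and X :: "int \<Rightarrow> 'w \<Rightarrow> 'e"
  assumes X_measurable [measurable]: "\<And>i. X i \<in> measurable M N"
    and stationary: "strictly_stationary M N X"
begin

text \<open>The past up to time \<open>m\<close> is encoded as a measure, not as a set of sets, so
  that \<open>subalgebra\<close> and \<open>real_cond_exp\<close> apply to it.\<close>

definition past :: "int \<Rightarrow> 'w measure" where
  "past m = sigma (space M) {X i -` U \<inter> space M | i U. i \<in> {..m} \<and> U \<in> sets N}"

lemma space_past [simp]: "space (past m) = space M"
  unfolding past_def by (rule space_measure_of) auto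

lemma sets_past: "sets (past m) = generated_sigma M N X {..m}"
  unfolding past_def generated_sigma_def by (rule sets_measure_of) auto

lemma subalgebra_past: "subalgebra M (past m)"
proof -
  have "sets (past m) \<subseteq> sets M"
    unfolding sets_past generated_sigma_def
    by (rule sets.sigma_sets_subset) (auto intro: measurable_sets[OF X_measurable])
  then show ?thesis by (simp add: subalgebra_def)
qed

lemma past_mono: "m \<le> m' \<Longrightarrow> subalgebra (past m') (past m)"
proof -
  assume "m \<le> m'"
  then have "{X i -` U \<inter> space M | i U. i \<in> {..m} \<and> U \<in> sets N}
      \<subseteq> {X i -` U \<inter> space M | i U. i \<in> {..m'} \<and> U \<in> sets N}"
    using order_trans by fastforce
  from sigma_sets_subseteq[OF this] show "subalgebra (past m') (past m)"
    by (simp add: subalgebra_def sets_past generated_sigma_def)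
qed

lemma event_in_past:
  assumes "i \<le> m" "U \<in> sets N"
  shows "{\<omega> \<in> space M. X i \<omega> \<in> U} \<in> sets (past m)"
  unfolding sets_past generated_sigma_def using assms
  by (intro sigma_sets.Basic) (auto simp: vimage_def Int_def)

lemma shifted_path_in_space:
  "\<omega> \<in> space M \<Longrightarrow> (\<lambda>i. X (i + h) \<omega>) \<in> space (\<Pi>\<^sub>M i\<in>UNIV. N)"
  using measurable_space[OF X_measurable] by (auto simp: space_PiM)

text \<open>Induction over the generated sigma-field. Both properties are carried by one path set
  \<open>H\<close>: a path set that merely represents \<open>D\<close> might involve coordinates
  after \<open>m\<close>, and its shifted preimage would then be out of control.\<close>

lemma past_shift:
  assumes "D \<in> sets (past m)"
  shows "\<exists>H\<in>sets (\<Pi>\<^sub>M i\<in>UNIV. N). D = (\<lambda>\<omega> i. X i \<omega>) -` H \<inter> space M \<and>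
           (\<lambda>\<omega> i. X (i + h) \<omega>) -` H \<inter> space M \<in> sets (past (m + h))"
  using assms unfolding sets_past[of m] generated_sigma_def
proof (induction rule: sigma_sets.induct)
  case (Basic D)
  then obtain i U where iU: "D = X i -` U \<inter> space M" "i \<le> m" "U \<in> sets N" by auto
  define H where "H = (\<lambda>x. x i) -` U \<inter> space (\<Pi>\<^sub>M i\<in>(UNIV::int set). N)"
  have "H \<in> sets (\<Pi>\<^sub>M i\<in>UNIV. N)"
    unfolding H_def using iU by (intro measurable_sets[OF measurable_component_singleton]) auto
  moreover have "D = (\<lambda>\<omega> i. X i \<omega>) -` H \<inter> space M"
    unfolding H_def iU(1) using shifted_path_in_space[where h=0] by auto
  moreover have "(\<lambda>\<omega> i. X (i + h) \<omega>) -` H \<inter> space M = {\<omega> \<in> space M. X (i + h) \<omega> \<in> U}"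
    unfolding H_def using shifted_path_in_space[where h=h] by auto
  moreover have "{\<omega> \<in> space M. X (i + h) \<omega> \<in> U} \<in> sets (past (m + h))"
    using iU by (intro event_in_past) auto
  ultimately show ?case by (intro bexI[of _ H] conjI) simp_all
next
  case Empty
  show ?case by (rule bexI[of _ "{}"]) auto
next
  case (Compl D)
  then obtain H where H: "H\<in>sets (\<Pi>\<^sub>M i\<in>UNIV. N)" "D = (\<lambda>\<omega> i. X i \<omega>) -` H \<inter> space M"
      "(\<lambda>\<omega> i. X (i + h) \<omega>) -` H \<inter> space M \<in> sets (past (m + h))" by auto
  let ?H = "space (\<Pi>\<^sub>M i\<in>UNIV. N) - H"
  have "(\<lambda>\<omega> i. X (i + h) \<omega>) -` ?H \<inter> space M
      = space (past (m + h)) - (\<lambda>\<omega> i. X (i + h) \<omega>) -` H \<inter> space M"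
    using shifted_path_in_space[where h=h] by auto
  then have "(\<lambda>\<omega> i. X (i + h) \<omega>) -` ?H \<inter> space M \<in> sets (past (m + h))"
    using sets.compl_sets[OF H(3)] by simp
  moreover have "space M - D = (\<lambda>\<omega> i. X i \<omega>) -` ?H \<inter> space M"
    unfolding H(2) using shifted_path_in_space[where h=0] by auto
  ultimately show ?case using H(1) by (intro bexI[of _ ?H] conjI) simp_all
next
  case (Union D)
  then have "\<forall>n. \<exists>H. H\<in>sets (\<Pi>\<^sub>M i\<in>UNIV. N) \<and> D n = (\<lambda>\<omega> i. X i \<omega>) -` H \<inter> space M \<and>
      (\<lambda>\<omega> i. X (i + h) \<omega>) -` H \<inter> space M \<in> sets (past (m + h))" by blast
  then obtain H where H: "\<And>n. H n\<in>sets (\<Pi>\<^sub>M i\<in>UNIV. N)"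
     "\<And>n. D n = (\<lambda>\<omega> i. X i \<omega>) -` H n \<inter> space M"
     "\<And>n. (\<lambda>\<omega> i. X (i + h) \<omega>) -` H n \<inter> space M \<in> sets (past (m + h))" by metis
  have "(\<Union>n::nat. (\<lambda>\<omega> i. X (i + h) \<omega>) -` H n \<inter> space M) \<in> sets (past (m + h))"
    using H(3) by blast
  moreover have "(\<Union>n::nat. (\<lambda>\<omega> i. X (i + h) \<omega>) -` H n \<inter> space M)
      = (\<lambda>\<omega> i. X (i + h) \<omega>) -` (\<Union>n. H n) \<inter> space M" by auto
  moreover have "(\<Union>n. D n) = (\<lambda>\<omega> i. X i \<omega>) -` (\<Union>n. H n) \<inter> space M"
    using H(2) by auto
  moreover have "(\<Union>n. H n) \<in> sets (\<Pi>\<^sub>M i\<in>UNIV. N)" using H(1) by blast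
  ultimately show ?case by (intro bexI[of _ "\<Union>n. H n"] conjI) simp_all
qed

lemma prob_shift:
  assumes "H \<in> sets (\<Pi>\<^sub>M i\<in>UNIV. N)"
  shows "prob ((\<lambda>\<omega> i. X (i + h) \<omega>) -` H \<inter> space M) = prob ((\<lambda>\<omega> i. X i \<omega>) -` H \<inter> space M)"
proof -
  have m: "(\<lambda>\<omega> i. X (i + h) \<omega>) \<in> measurable M (\<Pi>\<^sub>M i\<in>UNIV. N)" for h
    by (rule measurable_PiM_single') (auto simp: measurable_space[OF X_measurable])
  have d: "distr M (\<Pi>\<^sub>M i\<in>UNIV. N) (\<lambda>\<omega> i. X (i + h) \<omega>) = distr M (\<Pi>\<^sub>M i\<in>UNIV. N) (\<lambda>\<omega> i. X i \<omega>)"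
    using stationary unfolding strictly_stationary_def by blast
  show ?thesis
    using measure_distr[OF m assms, of h] measure_distr[OF m assms, of 0] d by simp
qed

text \<open>The coefficient is anchored at time 0. Shifting by \<open>- k\<close> moves the
  observation to time 0 and \<open>D\<close> into the past of \<open>- n\<close>; all three
  probabilities are preserved because the events, and their intersection, are preimages of the path
  sets \<open>H\<close>, \<open>K\<close> and \<open>H \<inter> K\<close>.\<close>

lemma mixing_bound:
  assumes D: "D \<in> sets (past (k - int n))" and A: "A \<in> sets N"
  shows "\<bar>prob (D \<inter> {\<omega> \<in> space M. X k \<omega> \<in> A}) - prob D * prob {\<omega> \<in> space M. X k \<omega> \<in> A}\<bar>
           \<le> alpha_inf_1 M N X n"
proof -
  obtain H where H: "H\<in>sets (\<Pi>\<^sub>M i\<in>UNIV. N)" "D = (\<lambda>\<omega> i. X i \<omega>) -` H \<inter> space M"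
      "(\<lambda>\<omega> i. X (i + - k) \<omega>) -` H \<inter> space M \<in> sets (past (k - int n + - k))"
    using past_shift[OF D, of "- k"] by auto
  define K where "K = (\<lambda>x. x k) -` A \<inter> space (\<Pi>\<^sub>M i\<in>(UNIV::int set). N)"
  have K: "K \<in> sets (\<Pi>\<^sub>M i\<in>UNIV. N)"
    unfolding K_def using A by (intro measurable_sets[OF measurable_component_singleton]) auto
  define D' where "D' = (\<lambda>\<omega> i. X (i + - k) \<omega>) -` H \<inter> space M"
  define B' where "B' = {\<omega> \<in> space M. X 0 \<omega> \<in> A}"
  have KX: "(\<lambda>\<omega> i. X i \<omega>) -` K \<inter> space M = {\<omega> \<in> space M. X k \<omega> \<in> A}"
    using shifted_path_in_space[where h=0] unfolding K_def by auto
  have K': "(\<lambda>\<omega> i. X (i + - k) \<omega>) -` K \<inter> space M = B'"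
    using shifted_path_in_space[where h="-k"] unfolding K_def B'_def by auto
  have 1: "prob D = prob D'" unfolding D'_def H(2) by (rule prob_shift[OF H(1), symmetric])
  have 2: "prob {\<omega> \<in> space M. X k \<omega> \<in> A} = prob B'"
    using prob_shift[OF K, of "-k"] unfolding KX K' by simp
  have "D \<inter> {\<omega> \<in> space M. X k \<omega> \<in> A} = (\<lambda>\<omega> i. X i \<omega>) -` (H \<inter> K) \<inter> space M"
    unfolding KX[symmetric] H(2) by auto
  moreover have "D' \<inter> B' = (\<lambda>\<omega> i. X (i + - k) \<omega>) -` (H \<inter> K) \<inter> space M"
    unfolding K'[symmetric] D'_def by auto
  ultimately have 3: "prob (D \<inter> {\<omega> \<in> space M. X k \<omega> \<in> A}) = prob (D' \<inter> B')"
    using prob_shift[of "H \<inter> K" "-k"] H(1) K by auto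
  have D': "D' \<in> generated_sigma M N X {..- int n}"
    using H(3) unfolding sets_past D'_def by simp
  have B': "B' \<in> generated_sigma M N X {0}"
    unfolding B'_def generated_sigma_def using A
    by (intro sigma_sets.Basic) (auto simp: vimage_def Int_def)
  \<comment> \<open>This bounds the set of covariances above, without which a real supremum need not
    dominate its members.\<close>
  have bnd: "\<bar>prob (A \<inter> B) - prob A * prob B\<bar> \<le> 1" for A B
  proof -
    have "0 \<le> prob A * prob B" "prob A * prob B \<le> 1" by (auto intro: mult_le_one)
    then show ?thesis using prob_le_1[of "A \<inter> B"] measure_nonneg[of M "A \<inter> B"] by linarith
  qed
  show ?thesis unfolding 1 2 3 alpha_inf_1_def alpha_coeff_def
    by (rule cSUP_upper2[of _ _ "(D', B')"]) (use D' B' bnd in \<open>auto intro!: bdd_aboveI[of _ 1]\<close>)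
qed

text \<open>The conditional expectation of the indicator of \<open>B\<close> lies in [0,1] almost
  surely. Clipping changes it on a null set only, keeps it measurable for \<open>F\<close>, and
  makes the bounds hold at every point, so that integrability is immediate later on.\<close>

lemma conditional_probability:
  assumes "subalgebra M F" and B [measurable]: "B \<in> events"
  shows "\<exists>g\<in>(borel_measurable F :: ('w \<Rightarrow> real) set). (\<forall>\<omega>. 0 \<le> g \<omega> \<and> g \<omega> \<le> 1) \<and>
     (\<forall>h\<in>borel_measurable F. (\<forall>\<omega>. \<bar>h \<omega>\<bar> \<le> 1) \<longrightarrow>
        (\<integral>\<omega>. h \<omega> * g \<omega> \<partial>M) = (\<integral>\<omega>. h \<omega> * indicator B \<omega> \<partial>M))"
proof -
  interpret finite_measure_subalgebra M F
    by unfold_locales (rule assms(1))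
  define g' where "g' = real_cond_exp M F (indicator B)"
  define g where "g \<omega> = min 1 (max 0 (g' \<omega>))" for \<omega>
  have iB: "integrable M (indicator B :: _ \<Rightarrow> real)"
    by (rule integrable_const_bound[where B=1]) auto
  have [measurable]: "g' \<in> borel_measurable F" "g' \<in> borel_measurable M"
    unfolding g'_def by (simp_all add: borel_measurable_cond_exp2)
  have "AE \<omega> in M. 0 \<le> g' \<omega>" unfolding g'_def by (rule real_cond_exp_ge_c[OF iB]) auto
  moreover have "AE \<omega> in M. g' \<omega> \<le> 1"
    unfolding g'_def by (rule real_cond_exp_le_c[OF iB]) (auto simp: indicator_def)
  ultimately have eq: "AE \<omega> in M. g \<omega> = g' \<omega>" by (auto simp: g_def)
  have [measurable]: "g \<in> borel_measurable F" "g \<in> borel_measurable M" unfolding g_def by measurable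
  have "(\<integral>\<omega>. h \<omega> * g \<omega> \<partial>M) = (\<integral>\<omega>. h \<omega> * indicator B \<omega> \<partial>M)"
    if [measurable]: "h \<in> borel_measurable F" and h: "\<forall>\<omega>. \<bar>h \<omega>\<bar> \<le> 1" for h
  proof -
    have [measurable]: "h \<in> borel_measurable M" by (rule measurable_from_subalg[OF subalg that(1)])
    have "(\<integral>\<omega>. h \<omega> * g \<omega> \<partial>M) = (\<integral>\<omega>. h \<omega> * g' \<omega> \<partial>M)"
      using eq by (intro integral_cong_AE) auto
    also have "\<dots> = (\<integral>\<omega>. h \<omega> * indicator B \<omega> \<partial>M)"
      unfolding g'_def
      by (rule real_cond_exp_intg(2))
         (use h in \<open>auto intro!: integrable_const_bound[where B=1] simp: indicator_def\<close>)
    finally show ?thesis .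
  qed
  then show ?thesis by (intro bexI[of _ g]) (auto simp: g_def)
qed

end

subsection \<open>Martingale decomposition of the counting process\<close>

text \<open>Expand the square. Pairs at distance at least \<open>q\<close> vanish, and a closer pair
  contributes at most \<open>(p j + p k) / 2\<close> since \<open>2xy \<le> x^2 + y^2\<close>. Each
  index has at most \<open>2q\<close> close partners.\<close>

lemma (in prob_space) gap_orthogonal_second_moment:
  fixes Z :: "nat \<Rightarrow> 'a \<Rightarrow> real" and p :: "nat \<Rightarrow> real"
  assumes Z [measurable]: "\<And>k. k \<in> I \<Longrightarrow> Z k \<in> borel_measurable M"
    and bounded: "\<And>k \<omega>. k \<in> I \<Longrightarrow> \<bar>Z k \<omega>\<bar> \<le> 1"
    and square: "\<And>k. k \<in> I \<Longrightarrow> expectation (\<lambda>\<omega>. (Z k \<omega>)\<^sup>2) \<le> p k"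
    and orthogonal: "\<And>j k. j \<in> I \<Longrightarrow> k \<in> I \<Longrightarrow> j + q \<le> k \<Longrightarrow> expectation (\<lambda>\<omega>. Z j \<omega> * Z k \<omega>) = 0"
    and "finite I"
  shows "expectation (\<lambda>\<omega>. (\<Sum>k\<in>I. Z k \<omega>)\<^sup>2) \<le> 2 * real q * (\<Sum>k\<in>I. p k)"
proof -
  have int: "integrable M (\<lambda>\<omega>. Z j \<omega> * Z k \<omega>)" if "j \<in> I" "k \<in> I" for j k
    using that bounded by (intro integrable_const_bound[where B=1]) (auto simp: abs_mult intro!: mult_le_one)
  have p0: "0 \<le> p k" if "k \<in> I" for k
    by (rule order_trans[OF _ square[OF that]]) (rule Bochner_Integration.integral_nonneg, simp)
  have le: "expectation (\<lambda>\<omega>. Z j \<omega> * Z k \<omega>) \<le> (if j < k + q \<and> k < j + q then (p j + p k) / 2 else 0)"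
    if "j \<in> I" "k \<in> I" for j k
  proof -
    consider "j + q \<le> k" | "k + q \<le> j" | "j < k + q" "k < j + q" by linarith
    then show ?thesis
    proof cases
      case 1 then show ?thesis using orthogonal[OF that] by simp
    next
      case 2 then show ?thesis using orthogonal[OF that(2,1)] by (simp add: mult.commute)
    next
      case 3
      have "expectation (\<lambda>\<omega>. Z j \<omega> * Z k \<omega>)
          \<le> expectation (\<lambda>\<omega>. (Z j \<omega> * Z j \<omega> + Z k \<omega> * Z k \<omega>) / 2)"
      proof (rule integral_mono)
        fix \<omega> show "Z j \<omega> * Z k \<omega> \<le> (Z j \<omega> * Z j \<omega> + Z k \<omega> * Z k \<omega>) / 2"
          using sum_squares_bound[of "Z j \<omega>" "Z k \<omega>"] by (simp add: power2_eq_square)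
      qed (use int that in auto)
      also have "\<dots> \<le> (p j + p k) / 2"
        using square[OF that(1)] square[OF that(2)] int that by (simp add: power2_eq_square)
      finally show ?thesis using 3 by simp
    qed
  qed
  have count: "(\<Sum>k\<in>I. if j < k + q \<and> k < j + q then x else 0) \<le> 2 * real q * x"
    if "0 \<le> x" for j and x :: real
  proof -
    \<comment> \<open>Truncated subtraction cuts the interval at 0, which can only shorten it; its
      length stays at most \<open>2q\<close>.\<close>
    have "card {k\<in>I. j < k + q \<and> k < j + q} \<le> card {Suc j - q..<j + q}"
      by (rule card_mono) auto
    then have "real (card {k\<in>I. j < k + q \<and> k < j + q}) \<le> 2 * real q" by simp
    then have "real (card {k\<in>I. j < k + q \<and> k < j + q}) * x \<le> 2 * real q * x"
      using that by (rule mult_right_mono)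
    then show ?thesis using \<open>finite I\<close> by (simp flip: sum.inter_filter)
  qed
  have "expectation (\<lambda>\<omega>. (\<Sum>k\<in>I. Z k \<omega>)\<^sup>2) = (\<Sum>j\<in>I. \<Sum>k\<in>I. expectation (\<lambda>\<omega>. Z j \<omega> * Z k \<omega>))"
    unfolding power2_eq_square sum_product using int
    by (subst Bochner_Integration.integral_sum, auto)
  also have "\<dots> \<le> (\<Sum>j\<in>I. \<Sum>k\<in>I. if j < k + q \<and> k < j + q then (p j + p k) / 2 else 0)"
    by (intro sum_mono le)
  also have "\<dots> = (\<Sum>j\<in>I. \<Sum>k\<in>I. if j < k + q \<and> k < j + q then p j / 2 else 0)
      + (\<Sum>j\<in>I. \<Sum>k\<in>I. if j < k + q \<and> k < j + q then p k / 2 else 0)"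
    unfolding sum.distrib[symmetric] by (intro sum.cong) (auto simp: add_divide_distrib)
  also have "(\<Sum>j\<in>I. \<Sum>k\<in>I. if j < k + q \<and> k < j + q then p k / 2 else 0)
      = (\<Sum>j\<in>I. \<Sum>k\<in>I. if j < k + q \<and> k < j + q then p j / 2 else 0)"
    by (subst sum.swap) (intro sum.cong refl, auto)
  also have "(\<Sum>j\<in>I. \<Sum>k\<in>I. if j < k + q \<and> k < j + q then p j / 2 else 0)
      \<le> (\<Sum>j\<in>I. 2 * real q * (p j / 2))"
    by (intro sum_mono count) (simp add: p0)
  finally show ?thesis by (simp add: sum_distrib_left mult.assoc)
qed

context stationary_process
begin

text \<open>As \<open>g - p\<close> has mean zero, its L1 norm is twice its integral over
  \<open>D\<close>, the set where \<open>g\<close> exceeds \<open>p\<close>. This set belongs to the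
  past, so \<open>tower\<close> turns the integral into the covariance of \<open>D\<close> and the
  event, which mixing controls.\<close>

lemma conditional_probability_L1_deviation:
  assumes A: "A \<in> sets N"
    and g [measurable]: "g \<in> borel_measurable (past (k - int n))" and g01: "\<And>\<omega>. 0 \<le> g \<omega> \<and> g \<omega> \<le> 1"
    and tower: "\<And>h. h \<in> borel_measurable (past (k - int n)) \<Longrightarrow> (\<And>\<omega>. \<bar>h \<omega>\<bar> \<le> 1) \<Longrightarrow>
        expectation (\<lambda>\<omega>. h \<omega> * g \<omega>)
          = expectation (\<lambda>\<omega>. h \<omega> * indicator {\<omega> \<in> space M. X k \<omega> \<in> A} \<omega>)"
  shows "expectation (\<lambda>\<omega>. \<bar>g \<omega> - prob {\<omega> \<in> space M. X k \<omega> \<in> A}\<bar>) \<le> 2 * alpha_inf_1 M N X n"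
proof -
  define B where "B = {\<omega> \<in> space M. X k \<omega> \<in> A}"
  define p where "p = prob B"
  define D where "D = {\<omega> \<in> space M. p < g \<omega>}"
  have D: "D \<in> sets (past (k - int n))" unfolding D_def
    using borel_measurable_less[of "\<lambda>_. p" "past (k - int n)" g] by simp
  have [measurable]: "D \<in> events" "g \<in> borel_measurable M" "B \<in> events"
    using D measurable_from_subalg[OF subalgebra_past g] subalgebra_past[of "k - int n"] A
    unfolding B_def by (auto simp: subalgebra_def)
  have int: "integrable M (\<lambda>\<omega>. indicator D \<omega> * g \<omega>)" "integrable M g"
      "integrable M (indicator D :: _ \<Rightarrow> real)"
    using g01 by (auto intro!: integrable_const_bound[where B=1] simp: indicator_def)
  have tD: "expectation (\<lambda>\<omega>. indicator D \<omega> * g \<omega>) = prob (D \<inter> B)"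
  proof -
    have "expectation (\<lambda>\<omega>. indicator D \<omega> * g \<omega>) = expectation (\<lambda>\<omega>. indicator D \<omega> * indicator B \<omega>)"
      unfolding B_def using D by (intro tower) (auto simp: indicator_def)
    then show ?thesis by (simp flip: indicator_inter_arith)
  qed
  have t1: "expectation g = p"
    using tower[of "\<lambda>_. 1"] by (simp add: p_def B_def[symmetric])
  have "expectation (\<lambda>\<omega>. \<bar>g \<omega> - p\<bar>)
      = expectation (\<lambda>\<omega>. 2 * (indicator D \<omega> * g \<omega>) - 2 * p * indicator D \<omega> - g \<omega> + p)"
    by (intro Bochner_Integration.integral_cong) (auto simp: D_def indicator_def)
  also have "\<dots> = 2 * (prob (D \<inter> B) - prob D * p)"
    using int by (simp add: tD t1 prob_space)
  also have "\<dots> \<le> 2 * alpha_inf_1 M N X n"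
    using mixing_bound[OF D A] unfolding B_def[symmetric] p_def[symmetric] by (intro mult_left_mono) auto
  finally show ?thesis unfolding p_def B_def .
qed

text \<open>The gap \<open>q\<close> is left free, to be optimised against \<open>n\<close> later.
  The conditioning time \<open>int k - int q\<close> may be negative, which the two-sided process
  allows.\<close>

lemma martingale_decomposition:
  fixes A :: "nat \<Rightarrow> 'e set"
  assumes A: "\<And>k. k > 0 \<Longrightarrow> A k \<in> sets N"
    and B: "\<And>k. k > 0 \<Longrightarrow> B k = {\<omega> \<in> space M. X (int k) \<omega> \<in> A k}"
  shows "\<exists>U V. U \<in> borel_measurable M \<and> V \<in> borel_measurable M \<and>
      integrable M (\<lambda>\<omega>. (U \<omega>)\<^sup>2) \<and> integrable M V \<and>
      (\<forall>\<omega>. event_count B n \<omega> - (\<Sum>k=1..n. prob (B k)) = U \<omega> + V \<omega>) \<and>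
      expectation (\<lambda>\<omega>. (U \<omega>)\<^sup>2) \<le> 2 * real q * (\<Sum>k=1..n. prob (B k)) \<and>
      expectation (\<lambda>\<omega>. \<bar>V \<omega>\<bar>) \<le> 2 * real n * alpha_inf_1 M N X q"
proof -
  have ev: "B k \<in> events" if "k > 0" for k
    unfolding B[OF that] using A[OF that] by measurable
  have "\<forall>k\<in>{1..n}. \<exists>g :: 'w \<Rightarrow> real. g \<in> borel_measurable (past (int k - int q)) \<and> (\<forall>\<omega>. 0 \<le> g \<omega> \<and> g \<omega> \<le> 1) \<and>
     (\<forall>h\<in>borel_measurable (past (int k - int q)). (\<forall>\<omega>. \<bar>h \<omega>\<bar> \<le> 1) \<longrightarrow>
        (\<integral>\<omega>. h \<omega> * g \<omega> \<partial>M) = (\<integral>\<omega>. h \<omega> * indicator (B k) \<omega> \<partial>M))"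
    using conditional_probability[OF subalgebra_past ev] by (auto simp: Bex_def)
  then obtain g :: "nat \<Rightarrow> 'w \<Rightarrow> real" where
    g: "\<And>k. k \<in> {1..n} \<Longrightarrow> g k \<in> borel_measurable (past (int k - int q))"
    and g01: "\<And>k \<omega>. k \<in> {1..n} \<Longrightarrow> 0 \<le> g k \<omega> \<and> g k \<omega> \<le> 1"
    and tower: "\<And>k h. k \<in> {1..n} \<Longrightarrow> h \<in> borel_measurable (past (int k - int q)) \<Longrightarrow> (\<And>\<omega>. \<bar>h \<omega>\<bar> \<le> 1) \<Longrightarrow>
        expectation (\<lambda>\<omega>. h \<omega> * g k \<omega>) = expectation (\<lambda>\<omega>. h \<omega> * indicator (B k) \<omega>)"
    unfolding bchoice_iff by blast
  have gM [measurable]: "g k \<in> borel_measurable M" if "k \<in> {1..n}" for k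
    by (rule measurable_from_subalg[OF subalgebra_past g[OF that]])
  have ev' [measurable]: "B k \<in> events" if "k \<in> {1..n}" for k using ev that by simp
  define Z where "Z k \<omega> = indicator (B k) \<omega> - g k \<omega>" for k \<omega>
  have ZM [measurable]: "Z k \<in> borel_measurable M" if "k \<in> {1..n}" for k
    unfolding Z_def using that by measurable
  have Z1: "\<bar>Z k \<omega>\<bar> \<le> 1" if "k \<in> {1..n}" for k \<omega>
    using g01[OF that, of \<omega>] by (auto simp: Z_def indicator_def abs_le_iff)
  have int: "integrable M (\<lambda>\<omega>. f \<omega> * h \<omega>)"
    if "f \<in> borel_measurable M" "h \<in> borel_measurable M" "\<And>\<omega>. \<bar>f \<omega>\<bar> \<le> 1" "\<And>\<omega>. \<bar>h \<omega>\<bar> \<le> 1" for f h :: "'w \<Rightarrow> real"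
    using that by (intro integrable_const_bound[where B=1]) (auto simp: abs_mult intro!: mult_le_one)
  have g1: "\<bar>g k \<omega>\<bar> \<le> 1" if "k \<in> {1..n}" for k \<omega> using g01[OF that, of \<omega>] by simp
  have i1: "\<bar>indicator S \<omega> :: real\<bar> \<le> 1" for S and \<omega> :: 'w by (simp add: indicator_def)
  \<comment> \<open>Testing \<open>tower\<close> with \<open>g k\<close> itself turns the cross term
    into the second moment of \<open>g k\<close>, so the second moment of \<open>Z k\<close> is
    \<open>prob (B k)\<close> minus that of \<open>g k\<close>.\<close>
  have square: "expectation (\<lambda>\<omega>. (Z k \<omega>)\<^sup>2) \<le> prob (B k)" if k: "k \<in> {1..n}" for k
  proof -
    have "expectation (\<lambda>\<omega>. (Z k \<omega>)\<^sup>2)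
        = expectation (\<lambda>\<omega>. indicator (B k) \<omega> * indicator (B k) \<omega> - 2 * (g k \<omega> * indicator (B k) \<omega>) + g k \<omega> * g k \<omega>)"
      by (rule arg_cong[where f=expectation]) (auto simp: Z_def power2_eq_square algebra_simps)
    also have "\<dots> = expectation (\<lambda>\<omega>. indicator (B k) \<omega> * indicator (B k) \<omega>) - expectation (\<lambda>\<omega>. g k \<omega> * g k \<omega>)"
      using tower[OF k g[OF k] g1[OF k]] k
      by (simp add: int gM[OF k] g1[OF k] i1 borel_measurable_indicator)
    also have "\<dots> \<le> expectation (\<lambda>\<omega>. indicator (B k) \<omega> * indicator (B k) \<omega>)"
      by simp
    also have "\<dots> = prob (B k)"
      using ev'[OF k] by (simp flip: indicator_inter_arith)
    finally show ?thesis .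
  qed
  \<comment> \<open>For \<open>j + q \<le> k\<close> both \<open>B j\<close> and \<open>g j\<close>
    are known at time \<open>int k - int q\<close>, so \<open>Z j\<close> is an admissible test
    function for \<open>g k\<close>.\<close>
  have orthogonal: "expectation (\<lambda>\<omega>. Z j \<omega> * Z k \<omega>) = 0" if jk: "j \<in> {1..n}" "k \<in> {1..n}" "j + q \<le> k" for j k
  proof -
    have sub: "subalgebra (past (int k - int q)) (past i)" if "i \<le> int j" for i
      using past_mono that jk by simp
    have "B j \<in> sets (past (int j))"
      using event_in_past[of "int j" "int j" "A j"] A B jk by simp
    then have "B j \<in> sets (past (int k - int q))"
      using sub[of "int j"] by (auto simp: subalgebra_def)
    moreover have "g j \<in> borel_measurable (past (int k - int q))"
      by (rule measurable_from_subalg[OF sub g[OF jk(1)]]) simp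
    ultimately have "Z j \<in> borel_measurable (past (int k - int q))"
      unfolding Z_def by measurable
    from tower[OF jk(2) this Z1[OF jk(1)]]
    have "expectation (\<lambda>\<omega>. Z j \<omega> * g k \<omega>) = expectation (\<lambda>\<omega>. Z j \<omega> * indicator (B k) \<omega>)" .
    then show ?thesis
      unfolding Z_def[of k] using jk by (simp add: right_diff_distrib int Z1 g1 i1 borel_measurable_indicator)
  qed
  define U where "U \<omega> = (\<Sum>k=1..n. Z k \<omega>)" for \<omega>
  define V where "V \<omega> = (\<Sum>k=1..n. g k \<omega> - prob (B k))" for \<omega>
  have [measurable]: "U \<in> borel_measurable M" "V \<in> borel_measurable M"
    unfolding U_def V_def by (auto intro!: borel_measurable_sum)
  have dev_int: "integrable M (\<lambda>\<omega>. g k \<omega> - prob (B k))" if "k \<in> {1..n}" for k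
    using that g01 by (intro Bochner_Integration.integrable_diff integrable_const_bound[where B=1]) auto
  have "integrable M (\<lambda>\<omega>. (U \<omega>)\<^sup>2)"
    unfolding U_def power2_eq_square sum_product using Z1
    by (intro Bochner_Integration.integrable_sum int) auto
  moreover have "integrable M V"
    unfolding V_def using dev_int by (intro Bochner_Integration.integrable_sum) auto
  moreover have "event_count B n \<omega> - (\<Sum>k=1..n. prob (B k)) = U \<omega> + V \<omega>" for \<omega>
    unfolding U_def V_def event_count_def Z_def by (simp add: sum_subtractf)
  moreover have "expectation (\<lambda>\<omega>. (U \<omega>)\<^sup>2) \<le> 2 * real q * (\<Sum>k=1..n. prob (B k))"
    unfolding U_def
    by (rule gap_orthogonal_second_moment) (use Z1 square orthogonal in auto)
  moreover have "expectation (\<lambda>\<omega>. \<bar>V \<omega>\<bar>) \<le> 2 * real n * alpha_inf_1 M N X q"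
  proof -
    have "expectation (\<lambda>\<omega>. \<bar>V \<omega>\<bar>) \<le> expectation (\<lambda>\<omega>. \<Sum>k=1..n. \<bar>g k \<omega> - prob (B k)\<bar>)"
    proof (rule integral_mono)
      show "integrable M (\<lambda>\<omega>. \<Sum>k=1..n. \<bar>g k \<omega> - prob (B k)\<bar>)"
        using dev_int by (intro Bochner_Integration.integrable_sum integrable_abs) auto
      show "integrable M (\<lambda>\<omega>. \<bar>V \<omega>\<bar>)" using \<open>integrable M V\<close> by (rule integrable_abs)
    qed (simp add: V_def sum_abs)
    also have "\<dots> = (\<Sum>k=1..n. expectation (\<lambda>\<omega>. \<bar>g k \<omega> - prob (B k)\<bar>))"
      using dev_int by (intro Bochner_Integration.integral_sum integrable_abs) auto
    also have "\<dots> \<le> (\<Sum>k=1..n. 2 * alpha_inf_1 M N X q)"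
    proof (rule sum_mono)
      fix k assume k: "k \<in> {1..n}"
      show "expectation (\<lambda>\<omega>. \<bar>g k \<omega> - prob (B k)\<bar>) \<le> 2 * alpha_inf_1 M N X q"
        using conditional_probability_L1_deviation[of "A k" "g k" "int k" q] A B g g01 tower k
        by simp
    qed
    also have "\<dots> = 2 * real n * alpha_inf_1 M N X q" by simp
    finally show ?thesis .
  qed
  ultimately show ?thesis by (intro exI[of _ U] exI[of _ V]) simp
qed

end

subsection \<open>Convergence criteria\<close>

text \<open>A pathwise criterion, to be used with \<open>s\<close> the counting process at a fixed
  outcome and \<open>e\<close> its mean. As \<open>s\<close> is monotone, an excess at
  \<open>n\<close> persists forward and a deficit persists backward, over a window in which
  \<open>e\<close> varies by about \<open>\<delta> * e n\<close>. All weights \<open>w\<close> there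
  are at least \<open>\<phi>\<close>, which contradicts the Cauchy criterion for the weighted
  series.\<close>

lemma tendsto_one_of_summable_weights:
  fixes s p w e :: "nat \<Rightarrow> real"
  assumes e_def: "\<And>n. e n = (\<Sum>k=1..n. p k)"
    and p: "\<And>k. k > 0 \<Longrightarrow> 0 \<le> p k \<and> p k \<le> 1"
    and "mono s" and e_top: "filterlim e at_top sequentially"
    and w_nonneg: "\<And>k. 0 \<le> w k"
    and deviation: "\<And>\<delta>. \<delta> > 0 \<Longrightarrow> \<exists>\<phi>>0. \<forall>n\<ge>1. \<delta> * e n < \<bar>s n - e n\<bar> \<longrightarrow> \<phi> \<le> w n"
    and summable: "summable (\<lambda>n. p (Suc n) * w (Suc n) / e (Suc n))"
  shows "(\<lambda>n. s n / e n) \<longlonglongrightarrow> 1"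
proof -
  have e_Suc: "e (Suc n) = e n + p (Suc n)" for n by (simp add: e_def)
  have e_mono: "e m \<le> e n" if "m \<le> n" for m n
    by (rule lift_Suc_mono_le[OF _ that]) (use p in \<open>simp add: e_Suc\<close>)
  have less_e: "m < n" if "e m < e n" for m n
    using e_mono[of n m] that by (meson not_le)
  \<comment> \<open>A discrete inverse of \<open>e\<close>: the last index before the level
    \<open>x\<close> is exceeded. It exists because \<open>e 0 = 0\<close> and \<open>e\<close> is
    unbounded.\<close>
  have level: "\<exists>m. e m \<le> x \<and> x < e (Suc m)" if "0 \<le> x" for x
  proof -
    obtain n where n: "x < e n"
      using e_top by (auto simp: filterlim_at_top_dense eventually_sequentially)
    define l where "l = (LEAST n. x < e n)"
    have l: "x < e l" unfolding l_def by (rule LeastI[of _ n]) (rule n)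
    have "l \<noteq> 0" using l that by (intro notI) (simp add: e_def)
    then obtain m where m: "l = Suc m" by (cases l) auto
    have "\<not> x < e m" using not_less_Least[of m "\<lambda>n. x < e n"] m unfolding l_def by simp
    then show ?thesis using l m by (intro exI[of _ m]) auto
  qed
  define c where "c k = p k * w k / e k" for k
  have "summable c" using summable unfolding c_def by (subst summable_Suc_iff[symmetric])
  \<comment> \<open>The increments of \<open>e\<close> are the \<open>p k\<close>, so the weighted
    sum over a window is at least \<open>\<phi>\<close> times the growth of \<open>e\<close>,
    divided by an upper bound \<open>y\<close> for \<open>e\<close> there.\<close>
  have window: "\<phi> * (e v - e u) / y \<le> sum c {Suc u..<Suc v}"
    if "u \<le> v" "0 < e u" "0 < y" "0 \<le> \<phi>" and k: "\<And>k. u < k \<Longrightarrow> k \<le> v \<Longrightarrow> \<phi> \<le> w k \<and> e k \<le> y" for u v y \<phi>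
  proof -
    have "e v - e u = sum p {Suc u..<Suc v}"
      using \<open>u \<le> v\<close> by (induction v rule: dec_induct) (auto simp: e_Suc)
    then have "\<phi> * (e v - e u) / y = (\<Sum>k=Suc u..<Suc v. p k * \<phi> / y)"
      by (simp add: sum_distrib_left sum_divide_distrib mult.commute del: sum.op_ivl_Suc)
    also have "\<dots> \<le> sum c {Suc u..<Suc v}"
      unfolding c_def
    proof (rule sum_mono)
      fix i assume i: "i \<in> {Suc u..<Suc v}"
      have "0 < e i" using e_mono[of u i] i that(2) by simp
      then show "p i * \<phi> / y \<le> p i * w i / e i"
        using i k[of i] p[of i] w_nonneg[of i] that by (intro frac_le mult_mono mult_nonneg_nonneg) auto
    qed
    finally show ?thesis .
  qed
  \<comment> \<open>A deviation of \<open>3 * \<delta>\<close> at \<open>n\<close> leaves room for a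
    deviation of \<open>\<delta>\<close> at every index whose mean lies between
    \<open>(1 - \<delta>) * e n\<close> and \<open>(1 + \<delta>) * e n\<close>.\<close>
  have close: "\<forall>\<^sub>F n in sequentially. \<bar>s n - e n\<bar> \<le> 3 * \<delta> * e n"
    if \<delta>: "0 < \<delta>" "\<delta> \<le> 1/2" for \<delta>
  proof -
    obtain \<phi> where \<phi>: "\<phi> > 0" "\<And>n. n \<ge> 1 \<Longrightarrow> \<delta> * e n < \<bar>s n - e n\<bar> \<Longrightarrow> \<phi> \<le> w n"
      using deviation[OF \<delta>(1)] by auto
    have "0 < \<phi> * \<delta> / 4" using \<phi>(1) \<delta>(1) by simp
    then obtain N0 where N0: "\<And>m n. m \<ge> N0 \<Longrightarrow> \<bar>sum c {m..<n}\<bar> < \<phi> * \<delta> / 4"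
      using \<open>summable c\<close> unfolding summable_Cauchy real_norm_def by blast
    obtain N1 where N1: "\<And>n. n \<ge> N1 \<Longrightarrow> 0 < e n"
      using e_top by (auto simp: filterlim_at_top_dense eventually_sequentially)
    define N where "N = max N0 N1"
    \<comment> \<open>The term \<open>4 / \<delta>\<close> makes a single increment of
      \<open>e\<close>, which is at most 1, smaller than \<open>\<delta> * e n / 4\<close>. The term
      \<open>2 * e N\<close> keeps the backward window beyond \<open>N\<close>, since
      \<open>(1 - \<delta>) * e n\<close> is at least half of \<open>e n\<close>.\<close>
    have "\<forall>\<^sub>F n in sequentially. 2 * e N + 4 / \<delta> < e n"
      using e_top by (auto simp: filterlim_at_top_dense)
    moreover have "\<forall>\<^sub>F n in sequentially. n \<ge> N" by (rule eventually_ge_at_top)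
    ultimately show ?thesis
    proof eventually_elim
      case (elim n)
      have en: "0 < e n" "0 < e N" using N1 elim by (auto simp: N_def)
      then have "4 / \<delta> < e n" using elim by linarith
      then have e4: "4 < \<delta> * e n" using \<delta> by (simp add: field_simps)
      have d2: "\<delta> * \<delta> * e n \<le> \<delta> * e n"
        using \<delta> en by (intro mult_right_mono mult_left_le) auto
      have up: "\<not> (1 + 3 * \<delta>) * e n < s n"
      proof
        assume s: "(1 + 3 * \<delta>) * e n < s n"
        define x where "x = (1 + \<delta>) * e n"
        have x: "e n < x" "x \<le> 2 * e n"
          using \<delta> en by (auto simp: x_def algebra_simps intro: mult_right_mono)
        obtain m where m: "e m \<le> x" "x < e (Suc m)" using level[of x] x en by auto
        have "n < Suc m" by (rule less_e) (use x m in linarith)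
        have "\<phi> \<le> w k \<and> e k \<le> x" if "n < k" "k \<le> m" for k
        proof
          show "e k \<le> x" using e_mono[OF that(2)] m by linarith
          then have "(1 + \<delta>) * e k \<le> (1 + \<delta>) * x" using \<delta> by (intro mult_left_mono) auto
          also have "\<dots> \<le> (1 + 3 * \<delta>) * e n" using d2 by (simp add: x_def algebra_simps)
          also have "\<dots> < s k" using s monoD[OF \<open>mono s\<close>, of n k] that by simp
          finally show "\<phi> \<le> w k" using that by (intro \<phi>(2)) (auto simp: algebra_simps)
        qed
        then have "\<phi> * (e m - e n) / x \<le> sum c {Suc n..<Suc m}"
          using \<open>n < Suc m\<close> en x \<phi>(1) by (intro window) auto
        also have "\<dots> < \<phi> * \<delta> / 4" using N0[of "Suc n" "Suc m"] elim by (simp add: N_def abs_less_iff)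
        finally have "\<phi> * (e m - e n) < \<phi> * (\<delta> / 4 * x)"
          using x en by (simp add: pos_divide_less_eq mult_ac)
        then have "e m - e n < \<delta> / 4 * x" using \<phi>(1) by (simp only: mult_less_cancel_left_pos)
        also have "\<dots> \<le> \<delta> / 4 * (2 * e n)" using x \<delta> by (intro mult_left_mono) auto
        finally have "e m - e n < \<delta> * e n / 2" by simp
        moreover have "e (Suc m) \<le> e m + 1" using p[of "Suc m"] by (simp add: e_Suc)
        ultimately show False using m e4 by (simp add: x_def algebra_simps)
      qed
      have low: "\<not> s n < (1 - 3 * \<delta>) * e n"
      proof
        assume s: "s n < (1 - 3 * \<delta>) * e n"
        define x where "x = (1 - \<delta>) * e n"
        have "\<delta> * e n \<le> 1/2 * e n" using \<delta> en by (intro mult_right_mono) auto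
        then have x: "e n \<le> 2 * x" "x < e n"
          using \<delta> en by (auto simp: x_def algebra_simps)
        obtain m where m: "e m \<le> x" "x < e (Suc m)" using level[of x] x en by auto
        have "0 < 4 / \<delta>" using \<delta> by simp
        then have "N < Suc m" by (intro less_e) (use x m elim in linarith)
        have "m < n" by (rule less_e) (use x m in linarith)
        \<comment> \<open>The window starts after \<open>Suc m\<close>, not after \<open>m\<close>:
          \<open>e (Suc m)\<close> already exceeds \<open>x\<close>, and this lower bound on
          \<open>e k\<close> is what shows that \<open>s k\<close> is too small.\<close>
        have "\<phi> \<le> w k \<and> e k \<le> e n" if "Suc m < k" "k \<le> n" for k
        proof
          show "e k \<le> e n" using e_mono[OF that(2)] .
          have "s k \<le> s n" using monoD[OF \<open>mono s\<close>, of k n] that by simp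
          also have "\<dots> < (1 - 3 * \<delta>) * e n" by (rule s)
          also have "\<dots> \<le> (1 - \<delta>) * x"
          proof -
            have "0 \<le> \<delta> * \<delta> * e n" "0 \<le> \<delta> * e n" using en \<delta> by auto
            then show ?thesis by (simp add: x_def algebra_simps)
          qed
          also have "\<dots> \<le> (1 - \<delta>) * e k"
            using e_mono[of "Suc m" k] that m \<delta> by (intro mult_left_mono) auto
          finally show "\<phi> \<le> w k" using that by (intro \<phi>(2)) (auto simp: algebra_simps)
        qed
        then have "\<phi> * (e n - e (Suc m)) / e n \<le> sum c {Suc (Suc m)..<Suc n}"
          using \<open>m < n\<close> en e_mono[of N "Suc m"] \<open>N < Suc m\<close> \<phi>(1) by (intro window) auto
        also have "\<dots> < \<phi> * \<delta> / 4"
          using N0[of "Suc (Suc m)" "Suc n"] \<open>N < Suc m\<close> by (simp add: N_def abs_less_iff)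
        finally have "\<phi> * (e n - e (Suc m)) < \<phi> * (\<delta> / 4 * e n)"
          using en by (simp add: pos_divide_less_eq mult_ac)
        then have "e n - e (Suc m) < \<delta> / 4 * e n" using \<phi>(1) by (simp only: mult_less_cancel_left_pos)
        moreover have "e (Suc m) \<le> e m + 1" using p[of "Suc m"] by (simp add: e_Suc)
        ultimately show False using m e4 by (simp add: x_def algebra_simps)
      qed
      show ?case using up low by (auto simp: abs_le_iff algebra_simps not_less)
    qed
  qed
  show ?thesis
  proof (rule tendstoI)
    fix \<epsilon> :: real assume "0 < \<epsilon>"
    define \<delta> where "\<delta> = min (1/2) (\<epsilon> / 6)"
    have \<delta>: "0 < \<delta>" "\<delta> \<le> 1/2" "3 * \<delta> < \<epsilon>" using \<open>0 < \<epsilon>\<close> by (auto simp: \<delta>_def min_def)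
    have "\<forall>\<^sub>F n in sequentially. 0 < e n" using e_top by (auto simp: filterlim_at_top_dense)
    with close[OF \<delta>(1,2)] show "\<forall>\<^sub>F n in sequentially. dist (s n / e n) 1 < \<epsilon>"
    proof eventually_elim
      case (elim n)
      have "dist (s n / e n) 1 = \<bar>s n - e n\<bar> / e n"
        using elim by (simp add: dist_real_def field_simps abs_divide flip: diff_divide_distrib)
      also have "\<dots> \<le> 3 * \<delta>" using elim by (simp add: field_simps)
      finally show ?case using \<delta> by linarith
    qed
  qed
qed

text \<open>Tonelli for series: the sum has a finite integral and is therefore finite almost
  everywhere.\<close>

lemma AE_summable_of_summable_integrals:
  fixes f :: "nat \<Rightarrow> 'a \<Rightarrow> real"
  assumes int: "\<And>n. integrable M (f n)" and nonneg: "\<And>n \<omega>. 0 \<le> f n \<omega>"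
    and bound: "\<And>n. (\<integral>\<omega>. f n \<omega> \<partial>M) \<le> b n" and "summable b"
  shows "AE \<omega> in M. summable (\<lambda>n. f n \<omega>)"
proof -
  have [measurable]: "f n \<in> borel_measurable M" for n using int by (rule borel_measurable_integrable)
  have "summable (\<lambda>n. \<integral>\<omega>. f n \<omega> \<partial>M)"
    by (rule summable_comparison_test'[OF \<open>summable b\<close>, of 0])
       (use bound nonneg in \<open>auto simp: abs_of_nonneg Bochner_Integration.integral_nonneg\<close>)
  then have "(\<Sum>n. ennreal (\<integral>\<omega>. f n \<omega> \<partial>M)) \<noteq> \<infinity>"
    by (subst suminf_ennreal2) (use nonneg in \<open>auto simp: Bochner_Integration.integral_nonneg\<close>)
  moreover have "(\<integral>\<^sup>+\<omega>. (\<Sum>n. ennreal (f n \<omega>)) \<partial>M) = (\<Sum>n. ennreal (\<integral>\<omega>. f n \<omega> \<partial>M))"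
    by (subst nn_integral_suminf) (auto simp: nn_integral_eq_integral[OF int] nonneg)
  ultimately have "AE \<omega> in M. (\<Sum>n. ennreal (f n \<omega>)) \<noteq> \<infinity>"
    by (intro nn_integral_PInf_AE) auto
  then show ?thesis by eventually_elim (rule summable_suminf_not_top, auto simp: nonneg)
qed

text \<open>The deterministic half of the first claim, with \<open>u n\<close> the probability of no
  event from a fixed time up to \<open>n\<close>. Under a floor \<open>l\<close>, the drop of
  \<open>u\<close> over a dyadic block dominates the block's term in the condensed series; the drops
  telescope, so the series would converge.\<close>

lemma no_positive_floor_of_mixing_recursion:
  fixes u p :: "nat \<Rightarrow> real" and a C l :: real
  assumes "a > 0" "C \<ge> 1" "0 < l" "l \<le> 1"
    and p: "\<And>n. n \<ge> 1 \<Longrightarrow> 0 < p n \<and> p n \<le> 1"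
    and p_mono: "\<And>m n. 1 \<le> m \<Longrightarrow> m \<le> n \<Longrightarrow> p n \<le> p m"
    and p_top: "filterlim (\<lambda>n. real n powr a * p n) at_top sequentially"
    and p_sum: "\<not> summable (\<lambda>n. p (Suc n) powr ((a + 1) / a))"
    and "antimono u"
    and step: "\<And>n g. 1 \<le> g \<Longrightarrow> N + g \<le> n \<Longrightarrow> u n \<le> u (n - g) * (1 - p n) + C * real g powr (- a)"
  shows "\<exists>n. u n < l"
proof (rule ccontr)
  assume "\<not> (\<exists>n. u n < l)"
  then have u: "l \<le> u n" for n by (meson not_less)
  \<comment> \<open>Chosen so that \<open>y = \<kappa> * P i powr (- (1 / a))\<close> solves
    \<open>C * y powr (- a) = l * P i / 2\<close>: the mixing error then consumes half of the gain
    \<open>l * P i\<close>.\<close>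
  define \<kappa> where "\<kappa> = (2 * C / l) powr (1 / a)"
  have \<kappa>: "0 < \<kappa>" using assms by (simp add: \<kappa>_def)
  \<comment> \<open>The value at the right end of the block, hence a lower bound for
    \<open>p\<close> throughout the block.\<close>
  define P where "P i = p (2 ^ Suc i)" for i
  have P: "0 < P i" "P i \<le> 1" for i using p[of "2 ^ Suc i"] by (auto simp: P_def)
  have "\<forall>\<^sub>F n in sequentially. (4 * \<kappa>) powr a \<le> real n powr a * p n"
    using p_top by (auto simp: filterlim_at_top)
  moreover have "filterlim (\<lambda>i. 2 ^ Suc i :: nat) sequentially sequentially"
    by (rule filterlim_subseq) (auto simp: strict_mono_Suc_iff)
  ultimately have "\<forall>\<^sub>F i in sequentially. (4 * \<kappa>) powr a \<le> real (2 ^ Suc i) powr a * p (2 ^ Suc i)"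
    by (rule eventually_compose_filterlim)
  then obtain i0 where i0: "\<And>i. i \<ge> i0 \<Longrightarrow> (4 * \<kappa>) powr a \<le> real (2 ^ Suc i) powr a * P i"
    unfolding eventually_sequentially P_def by blast
  have block: "2 ^ i * P i powr ((a + 1) / a) \<le> 8 * \<kappa> / l * (u (2 ^ i) - u (2 ^ Suc i))"
    if i: "i \<ge> max i0 N" for i
  proof -
    define y where "y = \<kappa> * P i powr (- (1 / a))"
    define G where "G = nat \<lceil>y\<rceil>"
    have y1: "1 \<le> y"
    proof -
      have "1 \<le> \<kappa>" unfolding \<kappa>_def using assms by (intro ge_one_powr_ge_zero) (auto simp: field_simps)
      moreover have "1 \<le> P i powr (- (1 / a))"
        using P[of i] assms by (simp add: powr_minus powr_le1 one_le_inverse)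
      ultimately show ?thesis unfolding y_def by (metis mult_mono' mult_1 zero_le_one)
    qed
    \<comment> \<open>Rounding up at most doubles \<open>y\<close>, because
      \<open>1 \<le> y\<close>.\<close>
    have G: "y \<le> real G" "real G \<le> 2 * y" "1 \<le> G" using y1 by (auto simp: G_def) linarith+
    have ya: "y powr (- a) = l * P i / (2 * C)"
    proof -
      have "\<kappa> powr (- a) = l / (2 * C)"
        using assms(1-4) by (simp add: \<kappa>_def powr_powr powr_minus_divide)
      moreover have "(P i powr (- (1 / a))) powr (- a) = P i"
        using assms(1) P[of i] by (simp add: powr_powr)
      ultimately show ?thesis using P[of i] \<kappa> by (simp add: y_def powr_mult)
    qed
    have CG: "C * real G powr (- a) \<le> l * P i / 2"
    proof -
      have "real G powr (- a) \<le> y powr (- a)" using G y1 assms by (intro powr_mono2') auto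
      then have "C * real G powr (- a) \<le> C * (l * P i / (2 * C))"
        unfolding ya using assms by (intro mult_left_mono) auto
      then show ?thesis using assms by simp
    qed
    \<comment> \<open>This is where \<open>p_top\<close> enters: the gap must fit into the block. In
      the threshold \<open>4 * \<kappa>\<close>, one factor 2 pays for rounding and the other for
      the index \<open>2 ^ Suc i\<close>.\<close>
    have G_small: "G \<le> 2 ^ i"
    proof -
      have "4 * \<kappa> = ((4 * \<kappa>) powr a) powr (1 / a)" using assms \<kappa> by (simp add: powr_powr)
      also have "\<dots> \<le> (real (2 ^ Suc i) powr a * P i) powr (1 / a)"
        using i0[of i] i assms by (intro powr_mono2) auto
      also have "\<dots> = real (2 ^ Suc i) * P i powr (1 / a)"
        using assms P[of i] by (simp add: powr_mult powr_powr)
      finally have "2 * y \<le> 2 ^ i"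
        using P[of i] by (simp add: y_def powr_minus field_simps)
      then have "real G \<le> real (2 ^ i)" using G(2) unfolding of_nat_power of_nat_numeral by linarith
      then show ?thesis by (simp only: of_nat_le_iff)
    qed
    \<comment> \<open>Each step of length \<open>G\<close> gains at least \<open>l * P i\<close>
      from the floor on \<open>u\<close> and loses at most half of that to mixing.\<close>
    have iter: "u (2 ^ i + r * G) \<le> u (2 ^ i) - real r * (l * P i / 2)" if "r * G \<le> 2 ^ i" for r
      using that
    proof (induction r)
      case (Suc r)
      let ?n = "2 ^ i + Suc r * G"
      have "N \<le> 2 ^ i" using i less_exp[of i] by linarith
      then have "u ?n \<le> u (?n - G) * (1 - p ?n) + C * real G powr (- a)"
        using G by (intro step) auto
      also have "\<dots> \<le> u (?n - G) - l * P i + l * P i / 2"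
      proof -
        have "P i \<le> p ?n" unfolding P_def using Suc.prems G(3) by (intro p_mono) auto
        then have "l * P i \<le> u (?n - G) * p ?n"
          using u[of "?n - G"] P[of i] assms by (intro mult_mono) auto
        then show ?thesis using CG by (simp add: algebra_simps)
      qed
      also have "u (?n - G) = u (2 ^ i + r * G)" by (simp add: algebra_simps)
      finally show ?case using Suc by (simp add: algebra_simps add_divide_distrib)
    qed simp
    define R where "R = 2 ^ i div G"
    have RG: "R * G \<le> 2 ^ i" "2 ^ i < (R + 1) * G"
      using G dividend_less_div_times[of G "2 ^ i"] by (auto simp: R_def)
    \<comment> \<open>At least one step fits, so \<open>R + 1 \<le> 2 * R\<close>; with
      \<open>real G \<le> 2 * y\<close> this yields the factor 4 in \<open>Ry\<close>.\<close>
    have "1 \<le> R" using G_small G by (simp add: R_def Suc_le_eq div_greater_zero_iff)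
    have "real (2 ^ i) \<le> real ((R + 1) * G)" using RG by linarith
    also have "\<dots> \<le> (2 * real R) * (2 * y)"
      unfolding of_nat_mult using \<open>1 \<le> R\<close> G by (intro mult_mono) auto
    finally have Ry: "2 ^ i \<le> 4 * real R * y" by simp
    have "P i powr ((a + 1) / a) = P i * P i powr (1 / a)"
      using P[of i] assms by (simp add: add_divide_distrib powr_add)
    then have "2 ^ i * P i powr ((a + 1) / a) \<le> (4 * real R * y) * (P i * P i powr (1 / a))"
      using Ry P[of i] by (simp add: mult_right_mono)
    also have "\<dots> = 4 * \<kappa> * (real R * P i)"
      using P[of i] by (simp add: y_def powr_minus field_simps)
    also have "\<dots> = 8 * \<kappa> / l * (real R * (l * P i / 2))" using assms by simp
    also have "\<dots> \<le> 8 * \<kappa> / l * (u (2 ^ i) - u (2 ^ Suc i))"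
    proof (rule mult_left_mono)
      have "u (2 ^ Suc i) \<le> u (2 ^ i + R * G)" using RG by (intro antimonoD[OF \<open>antimono u\<close>]) simp
      then show "real R * (l * P i / 2) \<le> u (2 ^ i) - u (2 ^ Suc i)" using iter[OF RG(1)] by linarith
    qed (use \<kappa> assms in auto)
    finally show ?thesis .
  qed
  have "summable (\<lambda>i. u (2 ^ i) - u (2 ^ Suc i))"
  proof (rule bounded_imp_summable)
    fix n
    show "0 \<le> u (2 ^ n) - u (2 ^ Suc n)" using antimonoD[OF \<open>antimono u\<close>, of "2 ^ n" "2 ^ Suc n"] by simp
    have "(\<Sum>i\<le>n. u (2 ^ i) - u (2 ^ Suc i)) = u 1 - u (2 ^ Suc n)" by (induction n) auto
    then show "(\<Sum>i\<le>n. u (2 ^ i) - u (2 ^ Suc i)) \<le> u 1 - l" using u by simp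
  qed
  then have "summable (\<lambda>i. 8 * \<kappa> / l * (u (2 ^ i) - u (2 ^ Suc i)))" by (rule summable_mult)
  then have "summable (\<lambda>i. 2 ^ i * P i powr ((a + 1) / a))"
    by (rule summable_comparison_test'[where N="max i0 N"]) (use block in auto)
  then have "summable (\<lambda>i. 2 * (2 ^ i * P i powr ((a + 1) / a)))" by (rule summable_mult)
  then have "summable (\<lambda>i. 2 ^ Suc i * p (2 ^ Suc i) powr ((a + 1) / a))"
    by (simp add: P_def mult.assoc)
  then have "summable (\<lambda>i. 2 ^ i * p (2 ^ i) powr ((a + 1) / a))"
    by (subst (asm) summable_Suc_iff)
  then have "summable (\<lambda>n. p n powr ((a + 1) / a))"
  proof (subst condensation_test)
    fix m :: nat assume "0 < m"
    then show "p (Suc m) powr ((a + 1) / a) \<le> p m powr ((a + 1) / a)"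
      using p[of "Suc m"] assms(1) by (intro powr_mono2 p_mono) auto
  qed auto
  then show False using p_sum by (subst (asm) summable_Suc_iff[symmetric]) simp
qed

subsection \<open>Borel--Cantelli properties under a mixing rate\<close>

context stationary_process
begin

text \<open>The value \<open>r\<close> solves \<open>n * r powr (- a) = r\<close>. Rounding it up to
  the gap \<open>q\<close> does not worsen the mixing term and at most doubles the gap, whence the 4
  in the second-moment bound.\<close>

lemma martingale_decomposition_rate:
  fixes A :: "nat \<Rightarrow> 'e set"
  assumes A: "\<And>k. k > 0 \<Longrightarrow> A k \<in> sets N"
    and B: "\<And>k. k > 0 \<Longrightarrow> B k = {\<omega> \<in> space M. X (int k) \<omega> \<in> A k}"
    and "a > 0" and alpha: "\<And>n. n \<ge> 1 \<Longrightarrow> alpha_inf_1 M N X n \<le> C * real n powr (- a)"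
    and "C \<ge> 0" "n \<ge> 1"
  defines "r \<equiv> real n powr (1 / (a + 1))"
  shows "\<exists>U V. U \<in> borel_measurable M \<and> V \<in> borel_measurable M \<and>
      integrable M (\<lambda>\<omega>. (U \<omega>)\<^sup>2) \<and> integrable M V \<and>
      (\<forall>\<omega>. event_count B n \<omega> - (\<Sum>k=1..n. prob (B k)) = U \<omega> + V \<omega>) \<and>
      expectation (\<lambda>\<omega>. (U \<omega>)\<^sup>2) \<le> 4 * r * (\<Sum>k=1..n. prob (B k)) \<and>
      expectation (\<lambda>\<omega>. \<bar>V \<omega>\<bar>) \<le> 2 * C * r"
proof -
  define q where "q = nat \<lceil>r\<rceil>"
  have r1: "1 \<le> r" unfolding r_def using assms by (intro ge_one_powr_ge_zero) auto
  have q: "r \<le> real q" "real q \<le> 2 * r" "1 \<le> q" using r1 by (auto simp: q_def) linarith+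
  have "real n * r powr (- a) = r"
  proof -
    have "real n * r powr (- a) = real n powr (1 + - (a / (a + 1)))"
      using assms(6) by (simp only: powr_add) (simp add: r_def powr_powr)
    also have "1 + - (a / (a + 1)) = 1 / (a + 1)" using \<open>a > 0\<close> by (simp add: field_simps)
    finally show ?thesis by (simp add: r_def)
  qed
  moreover have "real q powr (- a) \<le> r powr (- a)" using q r1 \<open>a > 0\<close> by (intro powr_mono2') auto
  ultimately have nq: "real n * real q powr (- a) \<le> r" by (metis mult_left_mono of_nat_0_le_iff)
  have "2 * real n * alpha_inf_1 M N X q \<le> 2 * real n * (C * real q powr (- a))"
    using alpha[OF q(3)] by (intro mult_left_mono) auto
  also have "\<dots> = 2 * C * (real n * real q powr (- a))" by simp
  also have "\<dots> \<le> 2 * C * r" using nq \<open>C \<ge> 0\<close> by (intro mult_left_mono) auto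
  finally have 1: "2 * real n * alpha_inf_1 M N X q \<le> 2 * C * r" .
  have "2 * real q * (\<Sum>k=1..n. prob (B k)) \<le> (2 * (2 * r)) * (\<Sum>k=1..n. prob (B k))"
    using q by (intro mult_right_mono mult_left_mono sum_nonneg) auto
  then have 2: "2 * real q * (\<Sum>k=1..n. prob (B k)) \<le> 4 * r * (\<Sum>k=1..n. prob (B k))" by simp
  show ?thesis
    using martingale_decomposition[of A B n q, OF A B] 1 2 by (blast intro: order_trans)
qed

lemma event_mean_eq:
  assumes "\<And>k. k > 0 \<Longrightarrow> B k \<in> events"
  shows "event_mean M B n = (\<Sum>k=1..n. prob (B k))"
  unfolding event_mean_def event_count_def using assms
  by (subst Bochner_Integration.integral_sum) (auto intro!: integrable_const_bound[where B=1])

lemma events_of_observations: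
  assumes "\<And>k. k > 0 \<Longrightarrow> A k \<in> sets N" "\<And>k. k > 0 \<Longrightarrow> B k = {\<omega> \<in> space M. X (int k) \<omega> \<in> A k}"
  shows "k > 0 \<Longrightarrow> B k \<in> events"
  using assms by simp

text \<open>After division by \<open>E n\<close> both errors are controlled by
  \<open>\<rho> n\<close>, the reciprocal of the quantity in \<open>growth\<close>: the L2 bound on
  \<open>U\<close> gives its square root, the L1 bound on \<open>V\<close> gives a multiple of
  it.\<close>

lemma L1_borel_cantelli_of_mixing_rate:
  fixes A :: "nat \<Rightarrow> 'e set"
  assumes A: "\<And>k. k > 0 \<Longrightarrow> A k \<in> sets N"
    and B: "\<And>k. k > 0 \<Longrightarrow> B k = {\<omega> \<in> space M. X (int k) \<omega> \<in> A k}"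
    and "a > 0" and alpha: "\<And>n. n \<ge> 1 \<Longrightarrow> alpha_inf_1 M N X n \<le> C * real n powr (- a)"
    and "C \<ge> 0"
    and E: "\<And>n. E n = (\<Sum>k=1..n. prob (B k))" and E_pos: "\<And>n. n \<ge> 1 \<Longrightarrow> 0 < E n"
    and growth: "filterlim (\<lambda>n. real n powr (- (1 / (a + 1))) * E n) at_top sequentially"
  shows "(\<lambda>n. \<integral>\<omega>. \<bar>event_count B n \<omega> / event_mean M B n - 1\<bar> \<partial>M) \<longlonglongrightarrow> 0"
proof -
  note ev = events_of_observations[OF A B]
  have mean: "event_mean M B n = E n" for n unfolding E by (rule event_mean_eq) (rule ev)
  define \<rho> where "\<rho> n = real n powr (1 / (a + 1)) / E n" for n
  have \<rho>_lim: "\<rho> \<longlonglongrightarrow> 0"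
    using tendsto_inverse_0_at_top[OF growth]
    by (simp add: \<rho>_def[abs_def] powr_minus divide_inverse mult.commute)
  have bound: "expectation (\<lambda>\<omega>. \<bar>event_count B n \<omega> / E n - 1\<bar>) \<le> sqrt (4 * \<rho> n) + 2 * C * \<rho> n"
    if n: "n \<ge> 1" for n
  proof -
    define r where "r = real n powr (1 / (a + 1))"
    obtain U V where [measurable]: "U \<in> borel_measurable M" "V \<in> borel_measurable M" and
      UV: "integrable M (\<lambda>\<omega>. (U \<omega>)\<^sup>2)" "integrable M V"
        "\<And>\<omega>. event_count B n \<omega> - E n = U \<omega> + V \<omega>"
        "expectation (\<lambda>\<omega>. (U \<omega>)\<^sup>2) \<le> 4 * r * E n" "expectation (\<lambda>\<omega>. \<bar>V \<omega>\<bar>) \<le> 2 * C * r"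
      using martingale_decomposition_rate[OF A B \<open>a > 0\<close> alpha \<open>C \<ge> 0\<close> n]
      unfolding E r_def by blast
    have iU: "integrable M U" by (rule square_integrable_imp_integrable) (use UV in auto)
    \<comment> \<open>Nonnegativity of the variance of \<open>\<bar>U\<bar>\<close> serves as the
      Cauchy-Schwarz inequality, bounding the L1 norm by the L2 norm.\<close>
    have "0 \<le> variance (\<lambda>\<omega>. \<bar>U \<omega>\<bar>)" by (rule variance_positive)
    also have "\<dots> = expectation (\<lambda>\<omega>. (U \<omega>)\<^sup>2) - (expectation (\<lambda>\<omega>. \<bar>U \<omega>\<bar>))\<^sup>2"
      using iU UV by (subst variance_eq) auto
    finally have "(expectation (\<lambda>\<omega>. \<bar>U \<omega>\<bar>))\<^sup>2 \<le> 4 * r * E n" using UV(4) by linarith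
    then have U: "expectation (\<lambda>\<omega>. \<bar>U \<omega>\<bar>) \<le> sqrt (4 * r * E n)" by (rule real_le_rsqrt)
    have "expectation (\<lambda>\<omega>. \<bar>event_count B n \<omega> / E n - 1\<bar>) = expectation (\<lambda>\<omega>. \<bar>U \<omega> + V \<omega>\<bar> / E n)"
    proof (rule arg_cong[where f=expectation], rule ext)
      fix \<omega>
      have "event_count B n \<omega> / E n - 1 = (U \<omega> + V \<omega>) / E n"
        using E_pos[OF n] by (simp add: diff_divide_distrib flip: UV(3))
      then show "\<bar>event_count B n \<omega> / E n - 1\<bar> = \<bar>U \<omega> + V \<omega>\<bar> / E n"
        using E_pos[OF n] by (simp add: abs_divide)
    qed
    also have "\<dots> \<le> expectation (\<lambda>\<omega>. (\<bar>U \<omega>\<bar> + \<bar>V \<omega>\<bar>) / E n)"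
      using iU UV E_pos[OF n] by (intro integral_mono) (auto intro!: divide_right_mono)
    also have "\<dots> = (expectation (\<lambda>\<omega>. \<bar>U \<omega>\<bar>) + expectation (\<lambda>\<omega>. \<bar>V \<omega>\<bar>)) / E n"
      using iU UV by simp
    also have "\<dots> \<le> (sqrt (4 * r * E n) + 2 * C * r) / E n"
      using U UV E_pos[OF n] by (intro divide_right_mono add_mono) auto
    also have "\<dots> = sqrt (4 * \<rho> n) + 2 * C * \<rho> n"
    proof -
      have "sqrt (4 * r * E n) / E n = sqrt (4 * r * E n / (E n)\<^sup>2)"
        using E_pos[OF n] by (simp add: real_sqrt_divide)
      also have "\<dots> = sqrt (4 * \<rho> n)" using E_pos[OF n] by (simp add: \<rho>_def r_def power2_eq_square)
      finally show ?thesis by (simp add: add_divide_distrib \<rho>_def r_def)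
    qed
    finally show ?thesis .
  qed
  show ?thesis unfolding mean
  proof (rule tendsto_sandwich[OF _ _ tendsto_const])
    show "(\<lambda>n. sqrt (4 * \<rho> n) + 2 * C * \<rho> n) \<longlonglongrightarrow> 0"
      using tendsto_add[OF tendsto_real_sqrt[OF tendsto_mult_left[OF \<rho>_lim, of 4]] tendsto_mult_left[OF \<rho>_lim, of "2 * C"]]
      by simp
    show "\<forall>\<^sub>F n in sequentially. expectation (\<lambda>\<omega>. \<bar>event_count B n \<omega> / E n - 1\<bar>) \<le> sqrt (4 * \<rho> n) + 2 * C * \<rho> n"
      using eventually_ge_at_top[of 1] by eventually_elim (rule bound)
  qed simp
qed

text \<open>The weight \<open>w n\<close> has expectation at most a constant times
  \<open>r n / E n\<close>, so the series in \<open>sum\<close> bounds the expected weighted series.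
  The latter converges almost surely, and the pathwise criterion applies at each such
  outcome.\<close>

lemma strong_borel_cantelli_of_mixing_rate:
  fixes A :: "nat \<Rightarrow> 'e set"
  assumes A: "\<And>k. k > 0 \<Longrightarrow> A k \<in> sets N"
    and B: "\<And>k. k > 0 \<Longrightarrow> B k = {\<omega> \<in> space M. X (int k) \<omega> \<in> A k}"
    and "a > 0" and alpha: "\<And>n. n \<ge> 1 \<Longrightarrow> alpha_inf_1 M N X n \<le> C * real n powr (- a)"
    and "C \<ge> 0"
    and E: "\<And>n. E n = (\<Sum>k=1..n. prob (B k))" and E_pos: "\<And>n. n \<ge> 1 \<Longrightarrow> 0 < E n"
    and E_top: "filterlim E at_top sequentially"
    and sum: "summable (\<lambda>n. real (Suc n) powr (1 / (a + 1)) * prob (B (Suc n)) / (E (Suc n))\<^sup>2)"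
  shows "AE \<omega> in M. (\<lambda>n. event_count B n \<omega> / event_mean M B n) \<longlonglongrightarrow> 1"
proof -
  note ev = events_of_observations[OF A B]
  have mean: "event_mean M B n = E n" for n unfolding E by (rule event_mean_eq) (rule ev)
  define r where "r n = real n powr (1 / (a + 1))" for n
  have "\<forall>n. \<exists>U V. n \<ge> 1 \<longrightarrow> U \<in> borel_measurable M \<and> V \<in> borel_measurable M \<and>
      integrable M (\<lambda>\<omega>. (U \<omega>)\<^sup>2) \<and> integrable M V \<and>
      (\<forall>\<omega>. event_count B n \<omega> - E n = U \<omega> + V \<omega>) \<and>
      expectation (\<lambda>\<omega>. (U \<omega>)\<^sup>2) \<le> 4 * r n * E n \<and>
      expectation (\<lambda>\<omega>. \<bar>V \<omega>\<bar>) \<le> 2 * C * r n"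
    using martingale_decomposition_rate[OF A B \<open>a > 0\<close> alpha \<open>C \<ge> 0\<close>]
    unfolding E r_def by blast
  then obtain U V where UV: "\<And>n. n \<ge> 1 \<Longrightarrow> U n \<in> borel_measurable M \<and> V n \<in> borel_measurable M \<and>
      integrable M (\<lambda>\<omega>. (U n \<omega>)\<^sup>2) \<and> integrable M (V n) \<and>
      (\<forall>\<omega>. event_count B n \<omega> - E n = U n \<omega> + V n \<omega>) \<and>
      expectation (\<lambda>\<omega>. (U n \<omega>)\<^sup>2) \<le> 4 * r n * E n \<and>
      expectation (\<lambda>\<omega>. \<bar>V n \<omega>\<bar>) \<le> 2 * C * r n"
    by metis
  \<comment> \<open>The decomposition is available for \<open>n \<ge> 1\<close> only; the value 0 at
    index 0 keeps \<open>w\<close> nonnegative everywhere.\<close>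
  define w where "w n \<omega> = (if n \<ge> 1 then (U n \<omega>)\<^sup>2 / (E n)\<^sup>2 + \<bar>V n \<omega>\<bar> / E n else 0)" for n \<omega>
  have w_nonneg: "0 \<le> w n \<omega>" for n \<omega> using E_pos[of n] by (auto simp: w_def)
  have "AE \<omega> in M. summable (\<lambda>n. prob (B (Suc n)) * w (Suc n) \<omega> / E (Suc n))"
  proof (rule AE_summable_of_summable_integrals)
    fix n
    show "integrable M (\<lambda>\<omega>. prob (B (Suc n)) * w (Suc n) \<omega> / E (Suc n))"
      unfolding w_def using UV[of "Suc n"] by simp
    show "0 \<le> prob (B (Suc n)) * w (Suc n) \<omega> / E (Suc n)" for \<omega>
      using w_nonneg[of "Suc n" \<omega>] E_pos[of "Suc n"] by simp
    have "expectation (w (Suc n))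
        = expectation (\<lambda>\<omega>. (U (Suc n) \<omega>)\<^sup>2) / (E (Suc n))\<^sup>2 + expectation (\<lambda>\<omega>. \<bar>V (Suc n) \<omega>\<bar>) / E (Suc n)"
      unfolding w_def using UV[of "Suc n"] by simp
    also have "\<dots> \<le> (4 * r (Suc n) * E (Suc n)) / (E (Suc n))\<^sup>2 + (2 * C * r (Suc n)) / E (Suc n)"
      using UV[of "Suc n"] E_pos[of "Suc n"] by (intro add_mono divide_right_mono) auto
    also have "\<dots> = (4 + 2 * C) * (r (Suc n) / E (Suc n))"
      using E_pos[of "Suc n"] by (simp add: power2_eq_square field_simps)
    finally have "prob (B (Suc n)) / E (Suc n) * expectation (w (Suc n))
        \<le> prob (B (Suc n)) / E (Suc n) * ((4 + 2 * C) * (r (Suc n) / E (Suc n)))"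
      using E_pos[of "Suc n"] by (intro mult_left_mono) auto
    then show "expectation (\<lambda>\<omega>. prob (B (Suc n)) * w (Suc n) \<omega> / E (Suc n))
        \<le> (4 + 2 * C) * (real (Suc n) powr (1 / (a + 1)) * prob (B (Suc n)) / (E (Suc n))\<^sup>2)"
      by (simp add: r_def power2_eq_square mult_ac)
  qed (rule summable_mult[OF sum])
  then show ?thesis unfolding mean
  proof eventually_elim
    case (elim \<omega>)
    show ?case
    proof (rule tendsto_one_of_summable_weights[OF E _ _ E_top w_nonneg _ elim])
      show "mono (\<lambda>n. event_count B n \<omega>)"
        unfolding event_count_def by (intro monoI sum_mono2) auto
      fix \<delta> :: real assume "\<delta> > 0"
      \<comment> \<open>A deviation beyond \<open>\<delta> * E n\<close> forces \<open>U\<close> or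
        \<open>V\<close> to reach half of it; the two entries are the resulting contributions to
        \<open>w\<close>.\<close>
      define \<phi> where "\<phi> = min (\<delta>\<^sup>2 / 4) (\<delta> / 2)"
      have "\<phi> > 0" using \<open>\<delta> > 0\<close> by (simp add: \<phi>_def)
      moreover have "\<phi> \<le> w n \<omega>" if n: "n \<ge> 1" and dev: "\<delta> * E n < \<bar>event_count B n \<omega> - E n\<bar>" for n
      proof -
        have "\<delta> * E n < \<bar>U n \<omega> + V n \<omega>\<bar>" using dev UV[OF n] by simp
        then consider "\<delta> * E n / 2 \<le> \<bar>U n \<omega>\<bar>" | "\<delta> * E n / 2 \<le> \<bar>V n \<omega>\<bar>" by linarith
        then show ?thesis
        proof cases
          case 1
          then have "(\<delta> * E n / 2)\<^sup>2 \<le> (U n \<omega>)\<^sup>2"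
            using \<open>\<delta> > 0\<close> E_pos[OF n] by (metis abs_le_square_iff abs_of_pos half_gt_zero mult_pos_pos)
          then have "\<delta>\<^sup>2 / 4 \<le> (U n \<omega>)\<^sup>2 / (E n)\<^sup>2"
            using E_pos[OF n] by (simp add: power_divide power_mult_distrib pos_le_divide_eq)
          moreover have "0 \<le> \<bar>V n \<omega>\<bar> / E n" using E_pos[OF n] by simp
          moreover have "w n \<omega> = (U n \<omega>)\<^sup>2 / (E n)\<^sup>2 + \<bar>V n \<omega>\<bar> / E n" using n by (simp add: w_def)
          ultimately have "\<delta>\<^sup>2 / 4 \<le> w n \<omega>" by linarith
          then show ?thesis by (simp add: \<phi>_def)
        next
          case 2
          then have "\<delta> / 2 \<le> \<bar>V n \<omega>\<bar> / E n"
            using E_pos[OF n] by (simp add: pos_le_divide_eq)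
          moreover have "0 \<le> (U n \<omega>)\<^sup>2 / (E n)\<^sup>2" by simp
          moreover have "w n \<omega> = (U n \<omega>)\<^sup>2 / (E n)\<^sup>2 + \<bar>V n \<omega>\<bar> / E n" using n by (simp add: w_def)
          ultimately have "\<delta> / 2 \<le> w n \<omega>" by linarith
          then show ?thesis by (simp add: \<phi>_def)
        qed
      qed
      ultimately show "\<exists>\<phi>>0. \<forall>n\<ge>1. \<delta> * E n < \<bar>event_count B n \<omega> - E n\<bar> \<longrightarrow> \<phi> \<le> w n \<omega>"
        by blast
    qed auto
  qed
qed

text \<open>For each \<open>L\<close>, the event of no occurrence from \<open>L\<close> to
  \<open>n - g\<close> lies in the past at distance \<open>g\<close> from \<open>B n\<close>, so
  mixing gives the recursion that excludes a positive floor. Hence almost surely some event occurs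
  after each \<open>L\<close>.\<close>

lemma borel_cantelli_of_mixing_rate:
  fixes A :: "nat \<Rightarrow> 'e set"
  assumes A: "\<And>k. k > 0 \<Longrightarrow> A k \<in> sets N"
    and B: "\<And>k. k > 0 \<Longrightarrow> B k = {\<omega> \<in> space M. X (int k) \<omega> \<in> A k}"
    and "a > 0" and alpha: "\<And>n. n \<ge> 1 \<Longrightarrow> alpha_inf_1 M N X n \<le> C * real n powr (- a)"
    and "C \<ge> 1"
    and p_mono: "\<And>m n. 1 \<le> m \<Longrightarrow> m \<le> n \<Longrightarrow> prob (B n) \<le> prob (B m)"
    and p_top: "filterlim (\<lambda>n. real n powr a * prob (B n)) at_top sequentially"
    and p_sum: "\<not> summable (\<lambda>n. prob (B (Suc n)) powr ((a + 1) / a))"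
  shows "borel_cantelli_seq M B"
proof -
  note ev [measurable] = events_of_observations[OF A B]
  \<comment> \<open>Divergence gives positive probabilities arbitrarily far out, and monotonicity
    carries positivity back to every index.\<close>
  have p_pos: "0 < prob (B n)" if "n \<ge> 1" for n
  proof -
    have "\<forall>\<^sub>F m in sequentially. 0 < real m powr a * prob (B m)"
      using p_top by (auto simp: filterlim_at_top_dense)
    moreover have "\<forall>\<^sub>F m in sequentially. n \<le> m" by (rule eventually_ge_at_top)
    ultimately have "\<forall>\<^sub>F m in sequentially. 0 < real m powr a * prob (B m) \<and> n \<le> m"
      by (rule eventually_conj)
    then obtain m where "0 < real m powr a * prob (B m)" "n \<le> m"
      using eventually_happens'[OF sequentially_bot] by blast
    then show ?thesis using p_mono[OF that, of m] by (simp add: zero_less_mult_iff)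
  qed
  have hit: "AE \<omega> in M. \<exists>k\<ge>L. \<omega> \<in> B k" if "L \<ge> 1" for L
  proof -
    define D where "D n = space M - (\<Union>k\<in>{L..n}. B k)" for n
    have D_past: "D n \<in> sets (past (int n))" for n
    proof -
      have "(\<Union>k\<in>{L..n}. B k) \<in> sets (past (int n))"
      proof (intro sets.finite_UN)
        fix k assume "k \<in> {L..n}"
        then show "B k \<in> sets (past (int n))"
          using event_in_past[of "int k" "int n" "A k"] A B \<open>L \<ge> 1\<close> by auto
      qed simp
      from sets.compl_sets[OF this] show ?thesis by (simp add: D_def)
    qed
    have [measurable]: "D n \<in> events" for n
      using D_past[of n] subalgebra_past[of "int n"] by (auto simp: subalgebra_def)
    define u where "u n = prob (D n)" for n
    have small: "\<exists>n. u n < l" if "0 < l" "l \<le> 1" for l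
    proof (rule no_positive_floor_of_mixing_recursion[OF \<open>a > 0\<close> \<open>C \<ge> 1\<close> that _ p_mono p_top p_sum])
      show "antimono u"
        unfolding u_def D_def by (intro antimonoI finite_measure_mono) (use \<open>L \<ge> 1\<close> in auto)
      fix n g :: nat assume g: "1 \<le> g" "L + g \<le> n"
      have n: "n > 0" using g by simp
      have Bn: "B n = {\<omega> \<in> space M. X (int n) \<omega> \<in> A n}" by (rule B[OF n])
      have "D n \<subseteq> D (n - g) - B n" using g by (auto simp: D_def)
      then have "u n \<le> prob (D (n - g) - B n)"
        unfolding u_def using n by (intro finite_measure_mono) auto
      also have "\<dots> = u (n - g) - prob (D (n - g) \<inter> B n)"
        unfolding u_def using n by (subst finite_measure_Diff') auto
      also have "\<dots> \<le> u (n - g) - (u (n - g) * prob (B n) - C * real g powr (- a))"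
      proof -
        have "D (n - g) \<in> sets (past (int n - int g))"
          using D_past[of "n - g"] g by (simp add: of_nat_diff)
        from mixing_bound[OF this A[OF n]] alpha[OF g(1)] show ?thesis
          unfolding Bn[symmetric] u_def by linarith
      qed
      finally show "u n \<le> u (n - g) * (1 - prob (B n)) + C * real g powr (- a)"
        by (simp add: algebra_simps)
    qed (use p_pos in auto)
    have "(\<Inter>n. D n) \<in> events" by measurable
    have "prob (\<Inter>n. D n) \<le> 0"
    proof (rule ccontr)
      \<comment> \<open>The probability of the intersection would itself be a positive floor for
        \<open>u\<close>.\<close>
      assume "\<not> prob (\<Inter>n. D n) \<le> 0"
      then obtain n where "u n < prob (\<Inter>n. D n)" using small[of "prob (\<Inter>n. D n)"] by auto
      moreover have "prob (\<Inter>n. D n) \<le> u n" unfolding u_def by (intro finite_measure_mono) auto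
      ultimately show False by simp
    qed
    then have "prob (\<Inter>n. D n) = 0" using measure_nonneg[of M "\<Inter>n. D n"] by linarith
    then have "AE \<omega> in M. \<omega> \<notin> (\<Inter>n. D n)"
      using \<open>(\<Inter>n. D n) \<in> events\<close> by (simp add: prob_eq_0)
    moreover have "AE \<omega> in M. \<omega> \<in> space M" by simp
    ultimately show ?thesis by eventually_elim (auto simp: D_def)
  qed
  then have hits: "AE \<omega> in M. \<forall>L. L \<ge> 1 \<longrightarrow> (\<exists>k\<ge>L. \<omega> \<in> B k)"
    by (subst AE_all_countable) auto
  \<comment> \<open>The outer index is moved past 0 because nothing is known about
    \<open>B 0\<close>, not even measurability.\<close>
  have "limsup B = (\<Inter>L. \<Union>k\<in>{Suc L..}. B k)"
  proof -
    have "(\<Inter>L. \<Union>k\<in>{L..}. B k) \<subseteq> (\<Inter>L. \<Union>k\<in>{Suc L..}. B k)" by blast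
    moreover have "(\<Inter>L. \<Union>k\<in>{Suc L..}. B k) \<subseteq> (\<Inter>L. \<Union>k\<in>{L..}. B k)"
      by (intro INF_mono) (auto dest: Suc_leD)
    ultimately show ?thesis unfolding limsup_INF_SUP by blast
  qed
  moreover have "(\<Inter>L. \<Union>k\<in>{Suc L..}. B k) \<in> events" using ev by (intro sets.countable_INT sets.countable_UN') auto
  moreover have "AE \<omega> in M. \<omega> \<in> (\<Inter>L. \<Union>k\<in>{Suc L..}. B k)"
    using hits
  proof eventually_elim
    case (elim \<omega>)
    have "\<exists>k\<ge>Suc L. \<omega> \<in> B k" for L using elim by simp
    then show ?case by auto
  qed
  ultimately show ?thesis unfolding borel_cantelli_seq_def by (simp add: prob_eq_1)
qed

end

section \<open>From the marginal law to the events, and the three Borel-Cantelli properties\<close>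

theorem corollary3p1:
  fixes M :: "'w measure"
    and X :: "int \<Rightarrow> 'w \<Rightarrow> 'e::polish_space"
    and \<mu> :: "'e measure"
    and A :: "nat \<Rightarrow> 'e set"
    and B :: "nat \<Rightarrow> 'w set"
    and E :: "nat \<Rightarrow> real"
    and a C :: real
  assumes "prob_space M"
    and "\<And>i. X i \<in> borel_measurable M"
    and "strictly_stationary M borel X"
    and "\<mu> = distr M borel (X 0)"
    and "\<And>k. k > 0 \<Longrightarrow> A k \<in> sets borel"
    and "measure \<mu> (A 1) > 0"
    and "\<not> summable (\<lambda>k. measure \<mu> (A (Suc k)))"
    and "\<And>k. k > 0 \<Longrightarrow> B k = {\<omega> \<in> space M. X (int k) \<omega> \<in> A k}"
    and "\<And>n. E n = (\<Sum>k=1..n. measure \<mu> (A k))"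
    and "a > 0"
    and "\<And>n. n \<ge> 1 \<Longrightarrow> alpha_inf_1 M borel X n \<le> C * real n powr (- a)"
  shows "(\<not> summable (\<lambda>n. measure \<mu> (A (Suc n)) powr ((a + 1) / a)) \<longrightarrow>
          filterlim (\<lambda>n. real n powr a * measure \<mu> (A n)) at_top sequentially \<longrightarrow>
          antimono_on {1..} (\<lambda>n. measure \<mu> (A n)) \<longrightarrow>
          borel_cantelli_seq M B)
       \<and> (filterlim (\<lambda>n. real n powr (- (1 / (a + 1))) * E n) at_top sequentially \<longrightarrow>
          L1_borel_cantelli_seq M B)
       \<and> (summable (\<lambda>n. real (Suc n) powr (1 / (a + 1)) * measure \<mu> (A (Suc n))
                          / (E (Suc n))\<^sup>2) \<longrightarrow>
          strongly_borel_cantelli_seq M B)"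
proof -
  interpret prob_space M by (rule assms(1))
  interpret stationary_process M borel X
    by unfold_locales (use assms(2,3) in auto)
  \<comment> \<open>Enlarging the constant gives it the lower bound 1, which ensures
    \<open>\<kappa> \<ge> 1\<close> in the dyadic argument and a nonnegative factor in the other two
    claims.\<close>
  define C' where "C' = max C 1"
  have alpha: "alpha_inf_1 M borel X n \<le> C' * real n powr (- a)" if "n \<ge> 1" for n
    by (rule order_trans[OF assms(11)[OF that]]) (simp add: C'_def mult_right_mono)
  have C': "C' \<ge> 1" "C' \<ge> 0" by (auto simp: C'_def)
  \<comment> \<open>Stationarity is assumed for whole paths; applied to a cylinder at coordinate 0
    it shows that every \<open>X (int k)\<close> has law \<open>\<mu>\<close>.\<close>
  have \<mu>: "measure \<mu> (A k) = prob (B k)" if k: "k > 0" for k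
  proof -
    define H where "H = (\<lambda>x. x 0) -` A k \<inter> space (\<Pi>\<^sub>M i\<in>(UNIV::int set). (borel :: 'e measure))"
    have H: "H \<in> sets (\<Pi>\<^sub>M i\<in>UNIV. borel)"
      unfolding H_def using assms(5)[OF k] by (intro measurable_sets[OF measurable_component_singleton]) auto
    have "measure \<mu> (A k) = prob (X 0 -` A k \<inter> space M)"
      unfolding assms(4) using assms(5)[OF k] by (intro measure_distr) auto
    also have "\<dots> = prob ((\<lambda>\<omega> i. X i \<omega>) -` H \<inter> space M)" by (simp add: H_def space_PiM vimage_def)
    also have "\<dots> = prob ((\<lambda>\<omega> i. X (i + int k) \<omega>) -` H \<inter> space M)"
      by (rule prob_shift[OF H, symmetric])
    also have "\<dots> = prob (B k)"
      unfolding assms(8)[OF k] by (rule arg_cong[where f=prob]) (auto simp: H_def space_PiM)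
    finally show ?thesis .
  qed
  have E: "E n = (\<Sum>k=1..n. prob (B k))" for n unfolding assms(9) by (intro sum.cong) (auto simp: \<mu>)
  have E_pos: "0 < E n" if "n \<ge> 1" for n
  proof -
    have "prob (B 1) \<le> E n" unfolding E using that by (intro member_le_sum) auto
    then show ?thesis using assms(6) \<mu>[of 1] by simp
  qed
  have not_summable: "\<not> summable (\<lambda>k. prob (B (Suc k)))" using assms(7) by (simp add: \<mu>)
  have E_top: "filterlim E at_top sequentially"
  proof -
    have E_sum: "E (Suc n) = (\<Sum>k\<le>n. prob (B (Suc k)))" for n
      unfolding E by (rule sum.reindex_bij_witness[of _ Suc "\<lambda>k. k - 1"]) auto
    have "\<exists>n. Z \<le> E n" for Z
    proof (rule ccontr)
      assume "\<not> (\<exists>n. Z \<le> E n)"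
      then have "(\<Sum>k\<le>n. prob (B (Suc k))) \<le> Z" for n
        using E_sum[of n] by (metis le_cases)
      then have "summable (\<lambda>k. prob (B (Suc k)))" by (intro bounded_imp_summable) auto
      then show False using not_summable by simp
    qed
    moreover have "E m \<le> E n" if "m \<le> n" for m n
      unfolding E using that by (intro sum_mono2) auto
    ultimately show ?thesis
      unfolding filterlim_at_top eventually_sequentially by (meson order_trans)
  qed
  show ?thesis
  proof (intro conjI impI)
    assume 1: "\<not> summable (\<lambda>n. measure \<mu> (A (Suc n)) powr ((a + 1) / a))"
      "filterlim (\<lambda>n. real n powr a * measure \<mu> (A n)) at_top sequentially"
      "antimono_on {1..} (\<lambda>n. measure \<mu> (A n))"
    have "filterlim (\<lambda>n. real n powr a * prob (B n)) at_top sequentially"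
      using 1(2)
    \<comment> \<open>The two sequences are matched only eventually, as \<open>A 0\<close> and
      \<open>B 0\<close> are unrelated.\<close>
    proof (rule filterlim_cong[OF refl refl, THEN iffD1, rotated])
      show "\<forall>\<^sub>F n in sequentially. real n powr a * measure \<mu> (A n) = real n powr a * prob (B n)"
        using eventually_gt_at_top[of 0] by eventually_elim (simp add: \<mu>)
    qed
    moreover have "prob (B n) \<le> prob (B m)" if "1 \<le> m" "m \<le> n" for m n
      using monotone_onD[OF 1(3), of m n] that by (simp add: \<mu>)
    ultimately show "borel_cantelli_seq M B"
      using 1(1) by (intro borel_cantelli_of_mixing_rate[OF assms(5,8) \<open>a > 0\<close> alpha C'(1)]) (auto simp: \<mu>)
  next
    assume "filterlim (\<lambda>n. real n powr (- (1 / (a + 1))) * E n) at_top sequentially"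
    then show "L1_borel_cantelli_seq M B"
      unfolding L1_borel_cantelli_seq_def
      using not_summable L1_borel_cantelli_of_mixing_rate[OF assms(5,8) \<open>a > 0\<close> alpha C'(2) E E_pos] by auto
  next
    assume "summable (\<lambda>n. real (Suc n) powr (1 / (a + 1)) * measure \<mu> (A (Suc n)) / (E (Suc n))\<^sup>2)"
    then show "strongly_borel_cantelli_seq M B"
      unfolding strongly_borel_cantelli_seq_def
      using not_summable strong_borel_cantelli_of_mixing_rate[OF assms(5,8) \<open>a > 0\<close> alpha C'(2) E E_pos E_top]
      by (auto simp: \<mu>)
  qed
qed

end
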